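(* Let $\lambda>0$, let $g=\begin{pmatrix}A&B\\C&D\end{pmatrix}\in Sp(n,\mathbb R)$ with $\det B\ne0$, and let $c'_g\in\mathbb C$. Then the operator $A'_g$ of $L^2(\mathbb R^n)$ with integral kernel $$a_g(x,y)=c'_g\,\exp\left(-i\lambda\left(\tfrac12x^tDB^{-1}x-(B^{-1}x)^ty+\tfrac12y^tB^{-1}Ay\right)\right)$$ is unitary if and only if $$|c'_g|=\left(\frac{\lambda}{2\pi}\right)^{n/2}|\det B|^{-1/2}.$$
   Context: Let $n\ge1$; vectors in $\mathbb R^n$ are columns and $x^ty=\sum_jx_jy_j$. $Sp(n,\mathbb R)$ is the group of real $2n\times2n$ matrices $M$ with $M^tJM=J$, $J=\begin{pmatrix}0&I_n\\-I_n&0\end{pmatrix}$, written in $n\times n$ blocks. The operator with integral kernel $a_g$ is the bounded operator of $L^2(\mathbb R^n)$ given on the Schwartz space $\mathcal S(\mathbb R^n)$ by $(A'_g\phi)(x)=\int_{\mathbb R^n}a_g(x,y)\phi(y)\,dy$ and extended by continuity to $L^2(\mathbb R^n)$. *)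

theory Defs
  imports "HOL-Analysis.Analysis"
begin

subsection \<open>The Hilbert space of complex square-integrable functions\<close>

definition square_integrable :: "('a::euclidean_space \<Rightarrow> complex) \<Rightarrow> bool" where
  "square_integrable f \<longleftrightarrow>
     f \<in> borel_measurable lborel \<and> integrable lborel (\<lambda>x. (norm (f x))\<^sup>2)"

lemma integrable_mult_square_integrable:
  assumes "square_integrable f" "square_integrable g"
  shows "integrable lborel (\<lambda>x. f x * cnj (g x))"
proof (rule Bochner_Integration.integrable_bound)
  show "integrable lborel (\<lambda>x. (norm (f x))\<^sup>2 + (norm (g x))\<^sup>2)"
    using assms by (auto simp: square_integrable_def)
  show "(\<lambda>x. f x * cnj (g x)) \<in> borel_measurable lborel"
  proof -
    have "cnj \<in> borel_measurable borel"
      by (intro borel_measurable_continuous_onI continuous_intros)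
    then have "(\<lambda>x. cnj (g x)) \<in> borel_measurable lborel"
      using assms(2) measurable_compose unfolding square_integrable_def by blast
    then show ?thesis
      using assms(1) by (auto simp: square_integrable_def)
  qed
  have "a * b \<le> a\<^sup>2 + b\<^sup>2" if "a \<ge> 0" "b \<ge> 0" for a b :: real
    using sum_squares_bound[of a b] that mult_nonneg_nonneg[OF that] by linarith
  then show "AE x in lborel. norm (f x * cnj (g x)) \<le> norm ((norm (f x))\<^sup>2 + (norm (g x))\<^sup>2)"
    by (auto simp: norm_mult)
qed

lemma square_integrable_add:
  assumes "square_integrable f" "square_integrable g"
  shows "square_integrable (\<lambda>x. f x + g x)"
  unfolding square_integrable_def
proof
  show m: "(\<lambda>x. f x + g x) \<in> borel_measurable lborel"
    using assms by (auto simp: square_integrable_def)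
  show "integrable lborel (\<lambda>x. (norm (f x + g x))\<^sup>2)"
  proof (rule Bochner_Integration.integrable_bound)
    show "integrable lborel (\<lambda>x. 2 * (norm (f x))\<^sup>2 + 2 * (norm (g x))\<^sup>2)"
      using assms by (auto simp: square_integrable_def)
    show "(\<lambda>x. (norm (f x + g x))\<^sup>2) \<in> borel_measurable lborel"
      using m by measurable
    have "(norm (a + b))\<^sup>2 \<le> 2 * (norm a)\<^sup>2 + 2 * (norm b)\<^sup>2" for a b :: complex
    proof -
      have "(norm (a + b))\<^sup>2 \<le> (norm a + norm b)\<^sup>2"
        by (intro power_mono norm_triangle_ineq) auto
      also have "\<dots> \<le> 2 * (norm a)\<^sup>2 + 2 * (norm b)\<^sup>2"
        using sum_squares_bound[of "norm a" "norm b"] by (simp add: power2_sum)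
      finally show ?thesis .
    qed
    then show "AE x in lborel. norm ((norm (f x + g x))\<^sup>2)
        \<le> norm (2 * (norm (f x))\<^sup>2 + 2 * (norm (g x))\<^sup>2)"
      by auto
  qed
qed

lemma square_integrable_cmult:
  assumes "square_integrable f"
  shows "square_integrable (\<lambda>x. c * f x)"
  using assms by (auto simp: square_integrable_def norm_mult power_mult_distrib)

lemma square_integrable_zero: "square_integrable (\<lambda>_. 0)"
  by (simp add: square_integrable_def)

lemma square_integrable_uminus:
  "square_integrable f \<Longrightarrow> square_integrable (\<lambda>x. - f x)"
  using square_integrable_cmult[of f "-1"] by simp

lemma square_integrable_diff:
  "square_integrable f \<Longrightarrow> square_integrable g \<Longrightarrow> square_integrable (\<lambda>x. f x - g x)"
  using square_integrable_add[of f "\<lambda>x. - g x"] square_integrable_uminus[of g] by simp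

lemma square_integrable_scaleR:
  "square_integrable f \<Longrightarrow> square_integrable (\<lambda>x. r *\<^sub>R f x)"
  using square_integrable_cmult[of f "of_real r"] by (simp add: scaleR_conv_of_real)

text \<open>Every Lebesgue measurable function agrees almost everywhere with a Borel function, so classes
  of Borel functions give the usual space.\<close>

definition L2_rel :: "('a::euclidean_space \<Rightarrow> complex) \<Rightarrow> ('a \<Rightarrow> complex) \<Rightarrow> bool" where
  "L2_rel f g \<longleftrightarrow> square_integrable f \<and> square_integrable g \<and> (AE x in lborel. f x = g x)"

quotient_type (overloaded) 'a L2 = "'a::euclidean_space \<Rightarrow> complex" / partial: L2_rel
  morphisms rep_L2 abs_L2
proof (rule part_equivpI)
  show "\<exists>f. L2_rel f (f :: 'a \<Rightarrow> complex)"
    by (rule exI[of _ "\<lambda>_. 0"]) (simp add: L2_rel_def square_integrable_zero)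
  show "symp (L2_rel :: ('a \<Rightarrow> complex) \<Rightarrow> _)"
    by (rule sympI) (auto simp: L2_rel_def)
  show "transp (L2_rel :: ('a \<Rightarrow> complex) \<Rightarrow> _)"
  proof (rule transpI)
    fix f g h :: "'a \<Rightarrow> complex"
    assume "L2_rel f g" "L2_rel g h"
    then show "L2_rel f h"
      by (auto simp: L2_rel_def elim!: AE_mp)
  qed
qed

lift_definition scaleC_L2 :: "complex \<Rightarrow> 'a::euclidean_space L2 \<Rightarrow> 'a L2" is
  "\<lambda>c f x. c * f x"
  by (auto simp: L2_rel_def square_integrable_cmult elim!: AE_mp)

lift_definition cinner_L2 :: "'a::euclidean_space L2 \<Rightarrow> 'a L2 \<Rightarrow> complex" is
  "\<lambda>f g. \<integral>x. f x * cnj (g x) \<partial>lborel"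
proof -
  fix f f' g g' :: "'a \<Rightarrow> complex"
  assume "L2_rel f f'" "L2_rel g g'"
  then have "square_integrable f" "square_integrable f'" "square_integrable g" "square_integrable g'"
    and ae: "AE x in lborel. f x = f' x" "AE x in lborel. g x = g' x"
    by (auto simp: L2_rel_def)
  then show "(\<integral>x. f x * cnj (g x) \<partial>lborel) = (\<integral>x. f' x * cnj (g' x) \<partial>lborel)"
    using integrable_mult_square_integrable[of f g] integrable_mult_square_integrable[of f' g']
    by (intro integral_cong_AE) (auto elim!: AE_mp)
qed

instantiation L2 :: (euclidean_space) real_inner
begin

lift_definition zero_L2 :: "'a L2" is "\<lambda>_. 0"
  by (simp add: L2_rel_def square_integrable_zero)

lift_definition plus_L2 :: "'a L2 \<Rightarrow> 'a L2 \<Rightarrow> 'a L2" is "\<lambda>f g x. f x + g x"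
  by (auto simp: L2_rel_def square_integrable_add elim!: AE_mp)

lift_definition minus_L2 :: "'a L2 \<Rightarrow> 'a L2 \<Rightarrow> 'a L2" is "\<lambda>f g x. f x - g x"
  by (auto simp: L2_rel_def square_integrable_diff elim!: AE_mp)

lift_definition uminus_L2 :: "'a L2 \<Rightarrow> 'a L2" is "\<lambda>f x. - f x"
  by (auto simp: L2_rel_def square_integrable_uminus elim!: AE_mp)

lift_definition scaleR_L2 :: "real \<Rightarrow> 'a L2 \<Rightarrow> 'a L2" is "\<lambda>r f x. r *\<^sub>R f x"
  by (auto simp: L2_rel_def square_integrable_scaleR elim!: AE_mp)

definition inner_L2 :: "'a L2 \<Rightarrow> 'a L2 \<Rightarrow> real" where
  "inner_L2 f g = Re (cinner_L2 f g)"

definition norm_L2 :: "'a L2 \<Rightarrow> real" where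
  "norm_L2 f = sqrt (inner f f)"

definition dist_L2 :: "'a L2 \<Rightarrow> 'a L2 \<Rightarrow> real" where
  "dist_L2 f g = norm (f - g)"

definition sgn_L2 :: "'a L2 \<Rightarrow> 'a L2" where
  "sgn_L2 f = inverse (norm f) *\<^sub>R f"

definition uniformity_L2 :: "('a L2 \<times> 'a L2) filter" where
  "uniformity_L2 = (INF e\<in>{0 <..}. principal {(x, y). dist x y < e})"

definition open_L2 :: "'a L2 set \<Rightarrow> bool" where
  "open_L2 U \<longleftrightarrow> (\<forall>x\<in>U. eventually (\<lambda>(x', y). x' = x \<longrightarrow> y \<in> U) uniformity)"

instance
proof
  fix f g h :: "'a L2" and r s :: real
  show "f + g + h = f + (g + h)"
    by transfer (auto simp: L2_rel_def add.assoc intro!: square_integrable_add)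
  show "f + g = g + f"
    by transfer (auto simp: L2_rel_def add.commute intro!: square_integrable_add)
  show "0 + f = f"
    by transfer (auto simp: L2_rel_def)
  show "- f + f = 0"
    by transfer (auto simp: L2_rel_def square_integrable_zero)
  show "f - g = f + - g"
    by transfer (auto simp: L2_rel_def intro!: square_integrable_diff)
  show "r *\<^sub>R (f + g) = r *\<^sub>R f + r *\<^sub>R g"
    by transfer (auto simp: L2_rel_def scaleR_add_right
        intro!: square_integrable_add square_integrable_scaleR)
  show "(r + s) *\<^sub>R f = r *\<^sub>R f + s *\<^sub>R f"
    by transfer (auto simp: L2_rel_def scaleR_add_left
        intro!: square_integrable_add square_integrable_scaleR)
  show "r *\<^sub>R s *\<^sub>R f = (r * s) *\<^sub>R f"
    by transfer (auto simp: L2_rel_def mult.assoc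
        intro!: square_integrable_cmult square_integrable_scaleR)
  show "1 *\<^sub>R f = f"
    by transfer (auto simp: L2_rel_def)
  show "dist f g = norm (f - g)" by (rule dist_L2_def)
  show "sgn f = inverse (norm f) *\<^sub>R f" by (simp add: sgn_L2_def)
  show "uniformity = (INF e\<in>{0 <..}. principal {(x, y :: 'a L2). dist x y < e})"
    by (rule uniformity_L2_def)
  show "open U \<longleftrightarrow> (\<forall>x\<in>U. eventually (\<lambda>(x', y). x' = x \<longrightarrow> y \<in> U) uniformity)"
    for U :: "'a L2 set" by (rule open_L2_def)
  show "norm f = sqrt (inner f f)" by (rule norm_L2_def)
  have "cinner_L2 g f = cnj (cinner_L2 f g)"
    by transfer (simp flip: Bochner_Integration.integral_cnj add: mult.commute)
  then show "inner f g = inner g f"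
    by (simp add: inner_L2_def)
  have "cinner_L2 (f + g) h = cinner_L2 f h + cinner_L2 g h"
    by transfer (auto simp: L2_rel_def distrib_right integrable_mult_square_integrable
        intro!: Bochner_Integration.integral_add)
  then show "inner (f + g) h = inner f h + inner g h"
    by (simp add: inner_L2_def)
  have "cinner_L2 (r *\<^sub>R f) g = of_real r * cinner_L2 f g"
    by transfer (simp add: scaleR_conv_of_real mult.assoc)
  then show "inner (r *\<^sub>R f) g = r * inner f g"
    by (simp add: inner_L2_def)
  have eq: "inner f f = (\<integral>x. (norm (rep_L2 f x))\<^sup>2 \<partial>lborel)"
    and sq: "square_integrable (rep_L2 f)"
  proof -
    have "L2_rel (rep_L2 f) (rep_L2 f)"
      by (rule Quotient3_rep_reflp[OF Quotient3_L2])
    then show "square_integrable (rep_L2 f)" by (simp add: L2_rel_def)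
    have "cinner_L2 f f = (\<integral>x. rep_L2 f x * cnj (rep_L2 f x) \<partial>lborel)"
      by (simp add: cinner_L2.rep_eq)
    also have "\<dots> = (\<integral>x. of_real ((norm (rep_L2 f x))\<^sup>2) \<partial>lborel)"
      by (simp only: complex_norm_square)
    also have "\<dots> = of_real (\<integral>x. (norm (rep_L2 f x))\<^sup>2 \<partial>lborel)"
      by (rule integral_complex_of_real)
    finally show "inner f f = (\<integral>x. (norm (rep_L2 f x))\<^sup>2 \<partial>lborel)"
      by (simp add: inner_L2_def)
  qed
  show "0 \<le> inner f f"
    unfolding eq by (intro integral_nonneg_AE) auto
  show "inner f f = 0 \<longleftrightarrow> f = 0"
  proof -
    have "inner f f = 0 \<longleftrightarrow> (AE x in lborel. (norm (rep_L2 f x))\<^sup>2 = 0)"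
      unfolding eq using sq
      by (intro integral_nonneg_eq_0_iff_AE) (auto simp: square_integrable_def)
    also have "\<dots> \<longleftrightarrow> L2_rel (rep_L2 f) (\<lambda>_. 0)"
      using sq by (simp add: L2_rel_def square_integrable_zero)
    also have "\<dots> \<longleftrightarrow> abs_L2 (rep_L2 f) = abs_L2 (\<lambda>_. 0)"
      using sq Quotient3_rel[OF Quotient3_L2, of "rep_L2 f" "\<lambda>_. 0"]
      by (auto simp: L2_rel_def square_integrable_zero)
    also have "\<dots> \<longleftrightarrow> f = 0"
      by (simp add: zero_L2_def Quotient3_abs_rep[OF Quotient3_L2])
    finally show ?thesis .
  qed
qed

end

definition bounded_operator_L2 :: "('a::euclidean_space L2 \<Rightarrow> 'a L2) \<Rightarrow> bool" where
  "bounded_operator_L2 T \<longleftrightarrow>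
     bounded_linear T \<and> (\<forall>c f. T (scaleC_L2 c f) = scaleC_L2 c (T f))"

definition unitary_L2 :: "('a::euclidean_space L2 \<Rightarrow> 'a L2) \<Rightarrow> bool" where
  "unitary_L2 T \<longleftrightarrow>
     bounded_operator_L2 T \<and> surj T \<and> (\<forall>f g. cinner_L2 (T f) (T g) = cinner_L2 f g)"

subsection \<open>Schwartz functions and integral operators\<close>

text \<open>Multi-indices of derivatives are lists of coordinate directions; a function is smooth iff
  all its iterated partial derivatives exist and are (Frechet) differentiable everywhere.\<close>

fun iter_partial :: "'n list \<Rightarrow> (real^'n \<Rightarrow> complex) \<Rightarrow> real^'n \<Rightarrow> complex" where
  "iter_partial [] f = f"
| "iter_partial (i # is) f = (\<lambda>x. frechet_derivative (iter_partial is f) (at x) (axis i 1))"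

definition schwartz :: "(real^'n \<Rightarrow> complex) set" where
  "schwartz = {f.
     (\<forall>is x. iter_partial is f differentiable (at x)) \<and>
     (\<forall>(\<alpha> :: 'n \<Rightarrow> nat) is.
        bounded (range (\<lambda>x. (\<Prod>j\<in>UNIV. (x $ j) ^ \<alpha> j) *\<^sub>R iter_partial is f x)))}"

definition integral_transform ::
    "(real^'n \<Rightarrow> real^'n \<Rightarrow> complex) \<Rightarrow> (real^'n \<Rightarrow> complex) \<Rightarrow> real^'n \<Rightarrow> complex" where
  "integral_transform a \<phi> = (\<lambda>x. \<integral>y. a x y * \<phi> y \<partial>lborel)"

text \<open>The bounded operator given by the kernel on Schwartz functions, extended by continuity. It is
  unique if it exists because Schwartz functions are dense; if no bounded extension exists,
  the description operator leaves the value unspecified.\<close>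

definition kernel_operator ::
    "(real^'n \<Rightarrow> real^'n \<Rightarrow> complex) \<Rightarrow> (real^'n) L2 \<Rightarrow> (real^'n) L2" where
  "kernel_operator a = (THE T. bounded_operator_L2 T \<and>
     (\<forall>\<phi>\<in>schwartz. square_integrable (integral_transform a \<phi>) \<and>
        T (abs_L2 \<phi>) = abs_L2 (integral_transform a \<phi>)))"

subsection \<open>The symplectic group\<close>

definition block_matrix ::
    "'a^'n::finite^'n \<Rightarrow> 'a^'n^'n \<Rightarrow> 'a^'n^'n \<Rightarrow> 'a^'n^'n \<Rightarrow> 'a^('n + 'n)^('n + 'n)" where
  "block_matrix A B C D = (\<chi> i j.
     case i of
       Inl k \<Rightarrow> (case j of Inl l \<Rightarrow> A $ k $ l | Inr l \<Rightarrow> B $ k $ l)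
     | Inr k \<Rightarrow> (case j of Inl l \<Rightarrow> C $ k $ l | Inr l \<Rightarrow> D $ k $ l))"

definition symplectic_J :: "real^('n::finite + 'n)^('n + 'n)" where
  "symplectic_J = block_matrix 0 (mat 1) (- mat 1) 0"

definition Sp :: "(real^('n::finite + 'n)^('n + 'n)) set" where
  "Sp = {M. transpose M ** symplectic_J ** M = symplectic_J}"

definition metaplectic_kernel ::
    "real \<Rightarrow> real^'n^'n \<Rightarrow> real^'n^'n \<Rightarrow> real^'n^'n \<Rightarrow> complex \<Rightarrow> real^'n \<Rightarrow> real^'n \<Rightarrow> complex" where
  "metaplectic_kernel lam A B D c x y =
     c * exp (- \<i> * of_real (lam *
       (1/2 * (x \<bullet> ((D ** matrix_inv B) *v x))
        - (matrix_inv B *v x) \<bullet> y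
        + 1/2 * (y \<bullet> ((matrix_inv B ** A) *v y)))))"

end

theory Submission
  imports Defs "HOL-Probability.Characteristic_Functions" "HOL-Probability.Sinc_Integral"
begin

text \<open>On Schwartz functions the kernel operator is \<^term>\<open>c\<close> times a composition of four maps: multiplication
  by a unimodular chirp, the Fourier transform, the substitution of the matrix
  \<^term>\<open>lam *\<^sub>R matrix_inv B\<close>, and multiplication by another chirp. By Plancherel's theorem the Fourier
  transform is \<^term>\<open>sqrt ((2 * pi) ^ n)\<close> times a unitary operator, and the substitution is
  \<^term>\<open>sqrt (\<bar>det B\<bar> / lam ^ n)\<close> times one, so the composition is unitary up to the product of these
  factors and the operator is unitary iff \<^term>\<open>cmod c\<close> is the inverse of the product.

  Plancherel's theorem is obtained from two ingredients: the sharp inequality for integrable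
  square-integrable functions, and Fourier inversion on Gaussians, which extends to the whole space
  because the Gaussians span a dense subspace. Applying the inequality to both signs of the exponent
  turns it into an equality.\<close>

subsection \<open>The Hilbert space L2\<close>

text \<open>The kernel operator is a definite description, so its unitarity says nothing until a
  bounded extension is exhibited and shown unique, for every value of \<open>c\<close>. Uniqueness
  is the density of Schwartz functions, and it is drawn from the unmodulated Gaussians
  \<open>gaussian t a 0\<close> alone: they are Schwartz functions, and they are also the vectors on
  which Fourier inversion is computed explicitly. Density means that no nonzero vector is orthogonal
  to all these Gaussians. Passing from orthogonality to operators needs a vector orthogonal to a
  closed proper subspace, hence completeness of the space; completeness is used a second time to
  extend the Fourier transform from integrable square-integrable functions. The detour through an
  inequality has a reason: removing a Gaussian damping factor by Fatou's lemma gives only an upper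
  bound for the norm of the transform. The constant \<open>(2 * pi) ^ n\<close> in it is the total
  mass of a heat kernel, and it equals the constant of the inversion formula, which is why nothing
  is lost when both are combined.\<close>

lemma L2_rel_refl: "square_integrable f \<Longrightarrow> L2_rel f f"
  by (simp add: L2_rel_def)

lemma square_integrable_rep: "square_integrable (rep_L2 u)"
  using Quotient3_rep_reflp[OF Quotient3_L2, of u] by (simp add: L2_rel_def)

lemma abs_rep_L2 [simp]: "abs_L2 (rep_L2 u) = u"
  by (rule Quotient3_abs_rep[OF Quotient3_L2])

lemma abs_L2_eq_iff:
  assumes "square_integrable f" "square_integrable g"
  shows "abs_L2 f = abs_L2 g \<longleftrightarrow> (AE x in lborel. f x = g x)"
  using Quotient3_rel[OF Quotient3_L2, of f g] assms by (auto simp: L2_rel_def)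

lemma rep_abs_L2_AE:
  assumes "square_integrable f"
  shows "AE x in lborel. rep_L2 (abs_L2 f) x = f x"
  using abs_L2_eq_iff[OF square_integrable_rep assms, of "abs_L2 f"] by simp

lemma L2_cases [case_names abs]:
  obtains f where "square_integrable f" "u = abs_L2 f"
  using square_integrable_rep abs_rep_L2 by metis

lemma abs_L2_add:
  "square_integrable f \<Longrightarrow> square_integrable g \<Longrightarrow> abs_L2 f + abs_L2 g = abs_L2 (\<lambda>x. f x + g x)"
  by (intro plus_L2.abs_eq L2_rel_refl)

lemma abs_L2_diff:
  "square_integrable f \<Longrightarrow> square_integrable g \<Longrightarrow> abs_L2 f - abs_L2 g = abs_L2 (\<lambda>x. f x - g x)"
  by (intro minus_L2.abs_eq L2_rel_refl)

lemma abs_L2_scaleC: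
  "square_integrable f \<Longrightarrow> scaleC_L2 c (abs_L2 f) = abs_L2 (\<lambda>x. c * f x)"
  by (intro scaleC_L2.abs_eq L2_rel_refl)

lemma abs_L2_scaleR:
  "square_integrable f \<Longrightarrow> r *\<^sub>R (abs_L2 f) = abs_L2 (\<lambda>x. r *\<^sub>R f x)"
  by (intro scaleR_L2.abs_eq L2_rel_refl)

lemma cinner_abs_L2:
  "square_integrable f \<Longrightarrow> square_integrable g \<Longrightarrow>
    cinner_L2 (abs_L2 f) (abs_L2 g) = (\<integral>x. f x * cnj (g x) \<partial>lborel)"
  by (intro cinner_L2.abs_eq L2_rel_refl)

lemma scaleR_L2_eq_scaleC: "r *\<^sub>R u = scaleC_L2 (of_real r) (u :: 'a::euclidean_space L2)"
  by (cases u rule: L2_cases) (simp add: abs_L2_scaleR abs_L2_scaleC scaleR_conv_of_real)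

lemma cinner_scaleC_left: "cinner_L2 (scaleC_L2 c u) w = c * cinner_L2 u w"
  by transfer (simp add: mult.assoc)

lemma cinner_commute: "cinner_L2 v u = cnj (cinner_L2 u v)"
  by transfer (simp flip: Bochner_Integration.integral_cnj add: mult.commute)

lemma cinner_scaleC_right: "cinner_L2 w (scaleC_L2 c u) = cnj c * cinner_L2 w u"
  using cinner_commute[of w "scaleC_L2 c u"] cinner_commute[of w u] by (simp add: cinner_scaleC_left)

lemma norm_abs_L2_sq:
  assumes "square_integrable f"
  shows "(norm (abs_L2 f))\<^sup>2 = (\<integral>x. (norm (f x))\<^sup>2 \<partial>lborel)"
proof -
  have "cinner_L2 (abs_L2 f) (abs_L2 f) = (\<integral>x. of_real ((norm (f x))\<^sup>2) \<partial>lborel)"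
    by (simp only: cinner_abs_L2[OF assms assms] complex_norm_square)
  also have "\<dots> = of_real (\<integral>x. (norm (f x))\<^sup>2 \<partial>lborel)"
    by (rule integral_complex_of_real)
  finally show ?thesis
    by (simp add: power2_norm_eq_inner inner_L2_def)
qed

lemma nn_integral_norm_abs_L2:
  assumes "square_integrable f"
  shows "(\<integral>\<^sup>+x. ennreal ((norm (f x))\<^sup>2) \<partial>lborel) = ennreal ((norm (abs_L2 f))\<^sup>2)"
  using assms unfolding norm_abs_L2_sq[OF assms]
  by (intro nn_integral_eq_integral) (auto simp: square_integrable_def)

lemma cinner_self: "cinner_L2 u u = of_real ((norm u)\<^sup>2)"
proof -
  have "cinner_L2 u u = cnj (cinner_L2 u u)"
    by (rule cinner_commute)
  then show ?thesis
    by (simp add: power2_norm_eq_inner inner_L2_def complex_eq_iff)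
qed

lemma norm_scaleC_L2: "norm (scaleC_L2 c u) = cmod c * norm u"
proof -
  have "of_real ((norm (scaleC_L2 c u))\<^sup>2) = complex_of_real ((cmod c * norm u)\<^sup>2)"
    unfolding cinner_self[symmetric] cinner_scaleC_left cinner_scaleC_right
    by (simp add: cinner_self power_mult_distrib complex_norm_square mult_ac del: of_real_power)
  then show ?thesis
    unfolding of_real_eq_iff by (rule power2_eq_imp_eq) auto
qed

lemma scaleC_L2_simps [simp]:
  "scaleC_L2 c (u + v) = scaleC_L2 c u + scaleC_L2 c v"
  "scaleC_L2 c (scaleC_L2 d u) = scaleC_L2 (c * d) u"
  "scaleC_L2 1 u = u"
  by (transfer, auto simp: L2_rel_def algebra_simps intro!: square_integrable_cmult square_integrable_add)+

lemma square_integrable_norm_le: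
  assumes "square_integrable f" "g \<in> borel_measurable borel" "\<And>x. norm (g x) \<le> norm (f x)"
  shows "square_integrable g"
  unfolding square_integrable_def
proof
  show "integrable lborel (\<lambda>x. (norm (g x))\<^sup>2)"
  proof (rule Bochner_Integration.integrable_bound)
    show "integrable lborel (\<lambda>x. (norm (f x))\<^sup>2)"
      using assms(1) by (simp add: square_integrable_def)
  qed (use assms in \<open>auto intro!: power_mono\<close>)
qed (use assms in auto)

lemma square_integrableI_nn:
  assumes [measurable]: "f \<in> borel_measurable borel"
    and "(\<integral>\<^sup>+x. ennreal ((norm (f x))\<^sup>2) \<partial>lborel) < \<infinity>"
  shows "square_integrable f"
  using assms by (auto simp: square_integrable_def integrable_iff_bounded)

lemma norm_abs_L2_leI:
  assumes "square_integrable f" "0 \<le> C"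
    and "(\<integral>\<^sup>+x. ennreal ((norm (f x))\<^sup>2) \<partial>lborel) \<le> ennreal (C\<^sup>2)"
  shows "norm (abs_L2 f) \<le> C"
proof (rule power2_le_imp_le)
  show "(norm (abs_L2 f))\<^sup>2 \<le> C\<^sup>2"
    using assms(3) unfolding nn_integral_norm_abs_L2[OF assms(1)] by (simp add: ennreal_le_iff)
qed fact

text \<open>Riesz-Fischer: if the increments decay geometrically, then the weighted sum
  \<^term>\<open>\<Sum>n. 2^n * (norm (f (Suc n) x - f n x))\<^sup>2\<close> has finite integral, so the sequence
  converges almost everywhere; Fatou's lemma identifies the limit.\<close>

lemma L2_convergent_geometric:
  fixes X :: "nat \<Rightarrow> 'a::euclidean_space L2"
  assumes fast: "\<And>n m. n \<le> m \<Longrightarrow> norm (X m - X n) \<le> (1/2) ^ n"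
  shows "convergent X"
proof -
  define f where "f n = rep_L2 (X n)" for n
  have sq: "square_integrable (f n)" and X: "X n = abs_L2 (f n)" for n
    by (simp_all add: f_def square_integrable_rep)
  have [measurable]: "f n \<in> borel_measurable borel" for n
    using sq by (simp add: square_integrable_def)
  have dist_f: "(\<integral>\<^sup>+x. ennreal ((norm (f m x - f n x))\<^sup>2) \<partial>lborel) \<le> ennreal ((1/4) ^ n)"
    if "n \<le> m" for m n
  proof -
    have "(norm (X m - X n))\<^sup>2 \<le> ((1/2) ^ n)\<^sup>2"
      by (rule power_mono[OF fast[OF that]]) simp
    also have "\<dots> = (1/4 :: real) ^ n"
      by (simp add: power2_eq_square flip: power_mult_distrib)
    finally show ?thesis
      using nn_integral_norm_abs_L2[OF square_integrable_diff[OF sq sq, of m n]]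
      by (simp add: X abs_L2_diff sq)
  qed
  \<comment> \<open>The squared increments have integrals at most \<open>(1/4) ^ n\<close>. The
    weight \<open>2 ^ n\<close> keeps the total integral finite, and pointwise boundedness of
    \<open>w n x\<close> still leaves increments of order \<open>sqrt (1/2) ^ n\<close>, which are
    summable.\<close>
  define w where "w n x = 2 ^ n * (norm (f (Suc n) x - f n x))\<^sup>2" for n x
  have [measurable]: "w n \<in> borel_measurable borel" for n
    unfolding w_def by measurable
  have "(\<integral>\<^sup>+x. (\<Sum>n. ennreal (w n x)) \<partial>lborel) = (\<Sum>n. \<integral>\<^sup>+x. ennreal (w n x) \<partial>lborel)"
    by (rule nn_integral_suminf) measurable
  also have "\<dots> \<le> (\<Sum>n. ennreal ((1/2) ^ n))"
  proof (rule suminf_le)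
    fix n
    have "(\<integral>\<^sup>+x. ennreal (w n x) \<partial>lborel)
        = ennreal (2 ^ n) * (\<integral>\<^sup>+x. ennreal ((norm (f (Suc n) x - f n x))\<^sup>2) \<partial>lborel)"
      unfolding w_def by (simp add: ennreal_mult nn_integral_cmult)
    also have "\<dots> \<le> ennreal (2 ^ n) * ennreal ((1/4) ^ n)"
      by (intro mult_left_mono dist_f) auto
    also have "\<dots> = ennreal ((1/2) ^ n)"
      by (simp add: ennreal_mult[symmetric] flip: power_mult_distrib)
    finally show "(\<integral>\<^sup>+x. ennreal (w n x) \<partial>lborel) \<le> ennreal ((1/2) ^ n)" .
  qed auto
  also have "\<dots> < \<infinity>"
    by (subst suminf_ennreal_eq[OF _ geometric_sums]) auto
  finally have "AE x in lborel. (\<Sum>n. ennreal (w n x)) \<noteq> \<infinity>"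
    by (intro nn_integral_PInf_AE) auto
  then have conv: "AE x in lborel. convergent (\<lambda>n. f n x)"
  proof (rule AE_mp, intro AE_I2 impI)
    fix x assume "(\<Sum>n. ennreal (w n x)) \<noteq> \<infinity>"
    then have "summable (\<lambda>n. w n x)"
      by (intro summable_suminf_not_top) (auto simp: w_def)
    then have "Bseq (\<lambda>n. w n x)"
      by (intro convergent_imp_Bseq) (auto dest: summable_LIMSEQ_zero simp: convergent_def)
    then obtain K where K: "K > 0" "\<And>n. norm (w n x) \<le> K"
      by (auto simp: Bseq_def)
    have "norm (f (Suc n) x - f n x) \<le> sqrt K * sqrt (1/2) ^ n" for n
    proof (rule power2_le_imp_le)
      have "(norm (f (Suc n) x - f n x))\<^sup>2 = w n x * (1/2) ^ n"
        by (simp add: w_def flip: power_mult_distrib)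
      also have "\<dots> \<le> K * (1/2) ^ n"
        using K(2)[of n] by (intro mult_right_mono) auto
      also have "\<dots> = (sqrt K * sqrt (1/2) ^ n)\<^sup>2"
      proof -
        have "(sqrt (1/2) ^ n)\<^sup>2 = ((sqrt (1/2))\<^sup>2) ^ n"
          by (simp only: power_mult[symmetric] mult.commute)
        then show ?thesis
          using K(1) by (simp add: power_mult_distrib)
      qed
      finally show "(norm (f (Suc n) x - f n x))\<^sup>2 \<le> (sqrt K * sqrt (1/2) ^ n)\<^sup>2" .
    qed (use K in auto)
    then have "summable (\<lambda>n. f (Suc n) x - f n x)"
      by - (rule summable_comparison_test'[OF summable_mult[OF summable_geometric], of "sqrt (1/2)" 0],
        simp_all add: real_sqrt_lt_1_iff)
    then have "convergent (\<lambda>n. f n x - f 0 x)"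
      by (simp add: summable_iff_convergent sum_lessThan_telescope[of "\<lambda>n. f n x"])
    from convergent_add[OF this convergent_const[of "f 0 x"]] show "convergent (\<lambda>n. f n x)"
      by simp
  qed
  define F where "F x = lim (\<lambda>n. f n x)" for x
  have F[measurable]: "F \<in> borel_measurable borel"
    unfolding F_def by measurable
  have lim: "AE x in lborel. (\<lambda>n. f n x) \<longlonglongrightarrow> F x"
    using conv by (auto simp: F_def convergent_LIMSEQ_iff)
  have dist_F: "(\<integral>\<^sup>+x. ennreal ((norm (F x - f n x))\<^sup>2) \<partial>lborel) \<le> ennreal (((1/2) ^ n)\<^sup>2)" for n
  proof -
    have "(\<integral>\<^sup>+x. ennreal ((norm (F x - f n x))\<^sup>2) \<partial>lborel)
        = (\<integral>\<^sup>+x. liminf (\<lambda>m. ennreal ((norm (f m x - f n x))\<^sup>2)) \<partial>lborel)"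
    proof (rule nn_integral_cong_AE, rule AE_mp[OF lim], intro AE_I2 impI)
      fix x assume "(\<lambda>m. f m x) \<longlonglongrightarrow> F x"
      then have "(\<lambda>m. ennreal ((norm (f m x - f n x))\<^sup>2)) \<longlonglongrightarrow> ennreal ((norm (F x - f n x))\<^sup>2)"
        by (intro tendsto_intros)
      then show "ennreal ((norm (F x - f n x))\<^sup>2) = liminf (\<lambda>m. ennreal ((norm (f m x - f n x))\<^sup>2))"
        by (intro lim_imp_Liminf[symmetric]) auto
    qed
    also have "\<dots> \<le> liminf (\<lambda>m. \<integral>\<^sup>+x. ennreal ((norm (f m x - f n x))\<^sup>2) \<partial>lborel)"
      by (rule nn_integral_liminf) measurable
    also have "\<dots> \<le> ennreal ((1/4) ^ n)"
      by (rule Liminf_le) (auto intro!: eventually_sequentiallyI[of n] dist_f)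
    also have "(1/4 :: real) ^ n = ((1/2) ^ n)\<^sup>2"
      by (simp add: power2_eq_square flip: power_mult_distrib)
    finally show ?thesis .
  qed
  have sqF_diff: "square_integrable (\<lambda>x. F x - f n x)" for n
    using dist_F[of n] by (intro square_integrableI_nn) (auto simp: less_top[symmetric] top_unique)
  have sqF: "square_integrable F"
    using square_integrable_add[OF sqF_diff[of 0] sq[of 0]] by simp
  have "norm (X n - abs_L2 F) \<le> (1/2) ^ n" for n
    using norm_abs_L2_leI[OF sqF_diff _ dist_F, of n]
    unfolding norm_minus_commute[of "X n"] by (simp add: X abs_L2_diff sq sqF)
  then have "(\<lambda>n. X n - abs_L2 F) \<longlonglongrightarrow> 0"
    by - (rule Lim_null_comparison[OF _ LIMSEQ_power_zero[of "1/2 :: real"]], auto)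
  then show ?thesis
    by (auto simp: convergent_def LIM_zero_iff)
qed

instance L2 :: (euclidean_space) complete_space
proof
  fix X :: "nat \<Rightarrow> 'a L2"
  assume X: "Cauchy X"
  have "\<exists>N. \<forall>m\<ge>N. \<forall>k\<ge>N. norm (X m - X k) < (1/2) ^ n" for n
    using X by (simp add: Cauchy_iff)
  then obtain N where N: "\<And>n m k. m \<ge> N n \<Longrightarrow> k \<ge> N n \<Longrightarrow> norm (X m - X k) < (1/2) ^ n"
    by metis
  \<comment> \<open>The sum dominates every \<open>N i\<close> with \<open>i \<le> n\<close>; the
    extra summand \<open>n\<close> makes \<open>r\<close> strictly increasing.\<close>
  define r where "r n = (\<Sum>i\<le>n. N i) + n" for n
  have r: "strict_mono r"
    by (auto simp: strict_mono_Suc_iff r_def)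
  have rN: "N n \<le> r m" if "n \<le> m" for n m
    using member_le_sum[of n "{..m}" N] that by (auto simp: r_def)
  have "convergent (X \<circ> r)"
    by (rule L2_convergent_geometric) (auto intro!: less_imp_le[OF N] rN)
  then obtain l where "(X \<circ> r) \<longlonglongrightarrow> l"
    by (auto simp: convergent_def)
  from Cauchy_converges_subseq[OF X r this] show "convergent X"
    by (auto simp: convergent_def)
qed

lemma norm_diff_scaleR_sq:
  fixes z v :: "'v::real_inner"
  shows "(norm (z - t *\<^sub>R v))\<^sup>2 = (norm z)\<^sup>2 - 2 * (t * (z \<bullet> v)) + t * (t * (v \<bullet> v))"
  by (simp add: power2_norm_eq_inner inner_simps inner_commute algebra_simps)

text \<open>A minimising sequence for the distance to \<^term>\<open>S\<close> is Cauchy by the parallelogram law.\<close>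

lemma closed_subspace_orthogonal_vector:
  fixes S :: "'v::{real_inner, complete_space} set"
  assumes S: "subspace S" "closed S" and "x \<notin> S"
  obtains w where "w \<noteq> 0" "\<And>v. v \<in> S \<Longrightarrow> w \<bullet> v = 0"
proof -
  define d where "d = infdist x S"
  have ne: "S \<noteq> {}" using subspace_0[OF S(1)] by auto
  have d_le: "d \<le> norm (x - s)" if "s \<in> S" for s
    using infdist_le[OF that, of x] by (simp add: d_def dist_norm)
  have d0: "0 \<le> d" by (simp add: d_def infdist_nonneg)
  have "\<exists>s\<in>S. norm (x - s) < d + 1 / Suc n" for n
  proof (rule ccontr)
    assume "\<not> ?thesis"
    then have "d + 1 / Suc n \<le> infdist x S"
      using ne by (auto simp: infdist_notempty dist_norm not_less intro!: cINF_greatest)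
    then show False by (simp add: d_def)
  qed
  then obtain s where s: "\<And>n. s n \<in> S" "\<And>n. norm (x - s n) < d + 1 / Suc n"
    by metis
  have par: "(norm (s m - s n))\<^sup>2 \<le> 2 * (norm (x - s m))\<^sup>2 + 2 * (norm (x - s n))\<^sup>2 - 4 * d\<^sup>2" for m n
  proof -
    have "(1/2) *\<^sub>R (s m + s n) \<in> S"
      using s(1) S(1) by (intro subspace_scale subspace_add)
    from d_le[OF this] have "d\<^sup>2 \<le> (norm (x - (1/2) *\<^sub>R (s m + s n)))\<^sup>2"
      using d0 by (intro power_mono)
    moreover have "(norm (s m - s n))\<^sup>2 + 4 * (norm (x - (1/2) *\<^sub>R (s m + s n)))\<^sup>2
        = 2 * (norm (x - s m))\<^sup>2 + 2 * (norm (x - s n))\<^sup>2"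
      by (simp add: power2_norm_eq_inner inner_simps algebra_simps inner_commute)
    ultimately show ?thesis by linarith
  qed
  define e where "e n = 2 * (d + 1 / Suc n)\<^sup>2 - 2 * d\<^sup>2" for n
  have e: "2 * (norm (x - s n))\<^sup>2 - 2 * d\<^sup>2 \<le> e n" for n
    using s(2)[of n] by (auto simp: e_def intro!: power_mono)
  have "(\<lambda>n. d + 1 / real (Suc n)) \<longlonglongrightarrow> d"
    using tendsto_add[OF tendsto_const[of d] LIMSEQ_inverse_real_of_nat]
    by (simp add: inverse_eq_divide)
  then have e_lim: "e \<longlonglongrightarrow> 0"
    unfolding e_def using tendsto_diff[OF tendsto_mult_left[OF tendsto_power] tendsto_const, of _ d _ 2 2 "2 * d\<^sup>2"]
    by fastforce
  have "Cauchy s"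
  proof (rule metric_CauchyI)
    fix r :: real assume "r > 0"
    then have "\<forall>\<^sub>F n in sequentially. e n < r\<^sup>2 / 2"
      using e_lim by (intro order_tendstoD) auto
    then obtain N where N: "\<And>n. n \<ge> N \<Longrightarrow> e n < r\<^sup>2 / 2"
      by (auto simp: eventually_sequentially)
    show "\<exists>M. \<forall>m\<ge>M. \<forall>n\<ge>M. dist (s m) (s n) < r"
    proof (intro exI[of _ N] allI impI)
      fix m n assume "N \<le> m" "N \<le> n"
      then have "(norm (s m - s n))\<^sup>2 < r\<^sup>2"
        using par[of m n] e[of m] e[of n] N[of m] N[of n] by linarith
      then show "dist (s m) (s n) < r"
        using \<open>r > 0\<close> by (auto simp: dist_norm intro: power_less_imp_less_base)
    qed
  qed
  then obtain l where l: "s \<longlonglongrightarrow> l"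
    by (auto simp: Cauchy_convergent_iff convergent_def)
  have lS: "l \<in> S"
    using closed_sequentially[OF S(2)] s(1) l by blast
  have nd: "norm (x - l) = d"
  proof (rule antisym)
    show "norm (x - l) \<le> d"
    proof (rule LIMSEQ_le)
      show "(\<lambda>n. norm (x - s n)) \<longlonglongrightarrow> norm (x - l)"
        by (intro tendsto_intros l)
      show "(\<lambda>n. d + 1 / real (Suc n)) \<longlonglongrightarrow> d" by fact
    qed (use s(2) in \<open>auto intro: less_imp_le\<close>)
  qed (rule d_le[OF lS])
  show ?thesis
  proof
    show "x - l \<noteq> 0" using lS \<open>x \<notin> S\<close> by auto
    fix v assume v: "v \<in> S"
    show "(x - l) \<bullet> v = 0"
    proof (cases "v = 0")
      case False
      \<comment> \<open>This is the coefficient of the projection of \<open>x - l\<close> onto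
        \<open>v\<close>: moving from \<open>l\<close> to \<open>l + t *\<^sub>R v\<close> lowers
        the squared distance by the square of the inner product divided by
        \<open>v \<bullet> v\<close>, while minimality of \<open>d\<close> allows no
        decrease.\<close>
      define t where "t = ((x - l) \<bullet> v) / (v \<bullet> v)"
      have "l + t *\<^sub>R v \<in> S"
        using lS v S(1) by (intro subspace_add subspace_scale)
      from d_le[OF this] have "(norm (x - l))\<^sup>2 \<le> (norm (x - l - t *\<^sub>R v))\<^sup>2"
        unfolding nd using d0 by (intro power_mono) (auto simp: diff_diff_add)
      also have "\<dots> = (norm (x - l))\<^sup>2 - ((x - l) \<bullet> v)\<^sup>2 / (v \<bullet> v)"
      proof -
        have "(norm (x - l - t *\<^sub>R v))\<^sup>2 = (norm (x - l))\<^sup>2 - 2 * (t * ((x - l) \<bullet> v)) + t * (t * (v \<bullet> v))"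
          using norm_diff_scaleR_sq[of "x - l" t v] .
        also have "t * (v \<bullet> v) = (x - l) \<bullet> v"
          using False by (simp add: t_def)
        finally show ?thesis
          by (simp add: t_def power2_eq_square)
      qed
      finally have "((x - l) \<bullet> v)\<^sup>2 / (v \<bullet> v) \<le> 0" by simp
      then show ?thesis
        using inner_gt_zero_iff[of v] False by (auto simp: divide_le_0_iff simp del: inner_gt_zero_iff)
    qed simp
  qed
qed

subsection \<open>Gaussians and their density\<close>

text \<open>Lebesgue measure is the image under \<open>T\<close> of the product of one-dimensional
  Lebesgue measures, so Fubini's theorem for finite products transfers. It serves both the Gaussian
  integrals and the integrable majorant of Schwartz functions.\<close>

lemma
  fixes f :: "'a::euclidean_space \<Rightarrow> real \<Rightarrow> 'c::{real_normed_field, banach, second_countable_topology}"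
  assumes f: "\<And>b. b \<in> Basis \<Longrightarrow> integrable lborel (f b)"
  shows integrable_lborel_prod: "integrable lborel (\<lambda>x. \<Prod>b\<in>Basis. f b (x \<bullet> b))"
    and integral_lborel_prod: "(\<integral>x. (\<Prod>b\<in>Basis. f b (x \<bullet> b)) \<partial>lborel) = (\<Prod>b\<in>Basis. \<integral>x. f b x \<partial>lborel)"
proof -
  interpret product_sigma_finite "\<lambda>_::'a. lborel :: real measure" ..
  define T where "T y = (\<Sum>b\<in>Basis. y b *\<^sub>R b)" for y :: "'a \<Rightarrow> real"
  have T[measurable]: "T \<in> (\<Pi>\<^sub>M b\<in>Basis. lborel) \<rightarrow>\<^sub>M borel"
    unfolding T_def[abs_def] by measurable
  have [measurable]: "f b \<in> borel_measurable borel" if "b \<in> Basis" for b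
    using borel_measurable_integrable[OF f[OF that]] by simp
  have m: "(\<lambda>x. \<Prod>b\<in>Basis. f b (x \<bullet> b)) \<in> borel_measurable borel"
    by measurable
  have eq: "(\<lambda>y. \<Prod>b\<in>Basis. f b (T y \<bullet> b)) = (\<lambda>y. \<Prod>b\<in>Basis. f b (y b))"
    by (auto simp: T_def intro!: prod.cong ext)
  have l: "(lborel :: 'a measure) = distr (\<Pi>\<^sub>M b\<in>Basis. lborel) borel T"
    unfolding T_def[abs_def] by (rule lborel_eq)
  show "integrable lborel (\<lambda>x. \<Prod>b\<in>Basis. f b (x \<bullet> b))"
    unfolding l by (subst integrable_distr_eq[OF T m]) (simp add: eq product_integrable_prod f)
  show "(\<integral>x. (\<Prod>b\<in>Basis. f b (x \<bullet> b)) \<partial>lborel) = (\<Prod>b\<in>Basis. \<integral>x. f b x \<partial>lborel)"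
    unfolding l by (subst integral_distr[OF T m]) (simp add: eq product_integral_prod f)
qed

lemma lborel_integral_affine:
  fixes f :: "'a::euclidean_space \<Rightarrow> 'b::{banach, second_countable_topology}"
  assumes [measurable]: "f \<in> borel_measurable borel" and "c \<noteq> 0"
  shows "(\<integral>x. f x \<partial>lborel) = \<bar>c\<bar> ^ DIM('a) *\<^sub>R (\<integral>x. f (a + c *\<^sub>R x) \<partial>lborel)"
  by (subst lborel_affine[OF \<open>c \<noteq> 0\<close>, of a]) (simp add: integral_density integral_distr)

lemma lborel_integrable_translate:
  fixes f :: "'a::euclidean_space \<Rightarrow> 'b::{banach, second_countable_topology}"
  assumes "integrable lborel f"
  shows "integrable lborel (\<lambda>x. f (a + x))"
proof -
  have "integrable (distr lborel borel ((+) a)) f"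
    using assms by (simp add: lborel_distr_plus)
  then show ?thesis
    by (subst (asm) integrable_distr_eq) (use assms in auto)
qed

text \<open>Both a centre \<open>a\<close> and a frequency \<open>b\<close> are carried so that the
  family is closed under the Fourier transform, which exchanges the two up to sign and replaces
  \<open>t\<close> by \<open>1 / t\<close>.\<close>

definition gaussian :: "real \<Rightarrow> 'a::euclidean_space \<Rightarrow> 'a \<Rightarrow> 'a \<Rightarrow> complex" where
  "gaussian t a b x = exp (of_real (- (t / 2) * (norm (x - a))\<^sup>2) + \<i> * of_real (b \<bullet> x))"

lemma norm_gaussian: "norm (gaussian t a b x) = exp (- (t / 2) * (norm (x - a))\<^sup>2)"
  by (simp add: gaussian_def)

lemma gaussian_eq_mult:
  "gaussian t a b x = of_real (exp (- (t / 2) * (norm (x - a))\<^sup>2)) * iexp (b \<bullet> x)"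
  by (simp only: gaussian_def exp_add exp_of_real)

lemma gaussian_0: "gaussian t a 0 x = of_real (exp (- (t / 2) * (norm (x - a))\<^sup>2))"
  by (simp only: gaussian_def inner_zero_left of_real_0 mult_zero_right add_0_right exp_of_real)

lemma gaussian_measurable [measurable]: "gaussian t a b \<in> borel_measurable borel"
  unfolding gaussian_def[abs_def] by (intro borel_measurable_continuous_onI continuous_intros)

text \<open>The value is the characteristic function of the standard normal distribution, rescaled
  by \<open>c = 1 / sqrt t\<close>.\<close>

lemma
  assumes t: "t > 0"
  shows integrable_gaussian_real: "integrable lborel (\<lambda>x::real. exp (of_real (- (t / 2) * x\<^sup>2) + \<i> * of_real (b * x)))" (is ?I)
    and integral_gaussian_real: "(\<integral>x. exp (of_real (- (t / 2) * x\<^sup>2) + \<i> * of_real (b * x)) \<partial>lborel)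
      = of_real (sqrt (2 * pi / t) * exp (- b\<^sup>2 / (2 * t)))" (is ?E)
proof -
  define g where "g b x = exp (of_real (- (1 / 2) * x\<^sup>2) + \<i> * of_real (b * x))" for b x :: real
  have [measurable]: "g b \<in> borel_measurable borel" for b
    unfolding g_def by (intro borel_measurable_continuous_onI continuous_intros)
  have dens: "g b x = of_real (sqrt (2 * pi)) * (std_normal_density x *\<^sub>R iexp (b * x))" for b x
    unfolding g_def exp_add exp_of_real by (simp add: std_normal_density_def scaleR_conv_of_real)
  have int: "integrable lborel (\<lambda>x. std_normal_density x *\<^sub>R iexp (b * x))" for b
  proof (rule Bochner_Integration.integrable_bound)
    show "integrable lborel std_normal_density"
      by (rule integrable_normal_density) simp
  qed auto
  have g_int: "integrable lborel (g b)" for b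
    unfolding dens[abs_def] by (intro integrable_mult_right int)
  have "(\<integral>x. std_normal_density x *\<^sub>R iexp (b * x) \<partial>lborel) = char std_normal_distribution b" for b
    unfolding char_def by (subst integral_density) auto
  then have g_eq: "(\<integral>x. g b x \<partial>lborel) = of_real (sqrt (2 * pi)) * of_real (exp (- b\<^sup>2 / 2))" for b
    unfolding dens integral_mult_right_zero by (simp add: char_std_normal_distribution)
  define c where "c = 1 / sqrt t"
  have c: "c \<noteq> 0" "c > 0" using t by (auto simp: c_def)
  have eq: "exp (of_real (- (t / 2) * x\<^sup>2) + \<i> * of_real (b * x)) = g (b * c) (0 + (1/c) * x)" for x
    using t by (simp add: g_def c_def power_mult_distrib)
  show ?I
    unfolding eq using c by (intro lborel_integrable_real_affine g_int) auto
  have "(\<integral>x. g (b * c) x \<partial>lborel) = \<bar>1/c\<bar> *\<^sub>R (\<integral>x. g (b * c) (0 + (1/c) * x) \<partial>lborel)"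
    using c by (intro lborel_integral_real_affine) auto
  then have "(\<integral>x. g (b * c) (0 + (1/c) * x) \<partial>lborel) = of_real c * (\<integral>x. g (b * c) x \<partial>lborel)"
    using c by (simp add: scaleR_conv_of_real)
  then show ?E
    unfolding eq g_eq using t by (simp add: c_def real_sqrt_divide power_divide)
qed

lemma
  assumes t: "t > 0"
  shows integrable_gaussian_centred: "integrable lborel (gaussian t (0::'a::euclidean_space) b)"
    and integral_gaussian_centred: "(\<integral>x. gaussian t (0::'a) b x \<partial>lborel)
      = of_real (sqrt (2 * pi / t) ^ DIM('a) * exp (- (norm b)\<^sup>2 / (2 * t)))"
proof -
  define g where "g e x = exp (of_real (- (t / 2) * x\<^sup>2) + \<i> * of_real ((b \<bullet> e) * x))" for e :: 'a and x :: real
  have eq: "gaussian t 0 b x = (\<Prod>e\<in>Basis. g e (x \<bullet> e))" for x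
  proof -
    have "(norm x)\<^sup>2 = (\<Sum>e\<in>Basis. (x \<bullet> e)\<^sup>2)" "b \<bullet> x = (\<Sum>e\<in>Basis. (b \<bullet> e) * (x \<bullet> e))"
      unfolding power2_norm_eq_inner by (subst euclidean_inner, simp add: power2_eq_square)+
    then show ?thesis
      by (simp add: gaussian_def g_def exp_sum[symmetric] sum.distrib sum_distrib_left sum_negf sum_subtractf)
  qed
  have "(norm b)\<^sup>2 = (\<Sum>e\<in>Basis. (b \<bullet> e)\<^sup>2)"
    unfolding power2_norm_eq_inner by (subst euclidean_inner) (simp add: power2_eq_square)
  then have e: "exp (- (norm b)\<^sup>2 / (2 * t)) = (\<Prod>e\<in>Basis. exp (- (b \<bullet> e)\<^sup>2 / (2 * t)))"
    by (simp add: exp_sum[symmetric] sum_negf sum_divide_distrib[symmetric])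
  have g: "integrable lborel (g e)" 
    and gi: "integral\<^sup>L lborel (g e) = of_real (sqrt (2 * pi / t) * exp (- (b \<bullet> e)\<^sup>2 / (2 * t)))" for e
    unfolding g_def[abs_def] by (rule integrable_gaussian_real[OF t] integral_gaussian_real[OF t])+
  show "integrable lborel (gaussian t (0::'a) b)"
    unfolding eq[abs_def] by (intro integrable_lborel_prod g)
  show "(\<integral>x. gaussian t (0::'a) b x \<partial>lborel)
      = of_real (sqrt (2 * pi / t) ^ DIM('a) * exp (- (norm b)\<^sup>2 / (2 * t)))"
    unfolding eq e by (subst integral_lborel_prod) (auto simp: g gi prod.distrib)
qed

lemma
  fixes a b :: "'a::euclidean_space"
  assumes t: "t > 0"
  shows integrable_gaussian: "integrable lborel (gaussian t a b)"
    and integral_gaussian: "(\<integral>x. gaussian t a b x \<partial>lborel)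
      = iexp (a \<bullet> b) * of_real (sqrt (2 * pi / t) ^ DIM('a) * exp (- (norm b)\<^sup>2 / (2 * t)))"
proof -
  have eq: "gaussian t a b (a + x) = iexp (a \<bullet> b) * gaussian t 0 b x" for x
    by (simp add: gaussian_def inner_add_right exp_add[symmetric] algebra_simps inner_commute)
  have eq': "gaussian t a b x = iexp (a \<bullet> b) * gaussian t 0 b (- a + x)" for x
    using eq[of "- a + x"] by simp
  show "integrable lborel (gaussian t a b)"
    unfolding eq'[abs_def] 
    by (intro integrable_mult_right lborel_integrable_translate integrable_gaussian_centred t)
  show "(\<integral>x. gaussian t a b x \<partial>lborel)
      = iexp (a \<bullet> b) * of_real (sqrt (2 * pi / t) ^ DIM('a) * exp (- (norm b)\<^sup>2 / (2 * t)))"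
    using lborel_integral_affine[of "gaussian t a b" 1 a] 
    by (simp add: eq integral_gaussian_centred[OF t])
qed

lemma square_integrable_gaussian:
  assumes "t > 0"
  shows "square_integrable (gaussian t a b)"
proof -
  have "(norm (gaussian t a b x))\<^sup>2 = norm (gaussian (2 * t) a b x)" for x
    by (simp add: norm_gaussian power2_eq_square flip: exp_add)
  then show ?thesis
    using integrable_gaussian[of "2 * t" a b] assms by (simp add: square_integrable_def)
qed

text \<open>After a substitution the integral is the indicator function convolved with a Gaussian of
  width \<open>1 / Suc n\<close>. Away from the frontier the indicator is locally constant, so the
  integrands converge pointwise, and the fixed Gaussian dominates them.\<close>

lemma indicator_box_gaussian_tendsto:
  fixes U :: "'a::euclidean_space set"
  assumes [measurable]: "U \<in> sets borel" and x: "x \<notin> frontier U"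
  shows "(\<lambda>n. \<integral>u. indicator U (x + (1 / real (Suc n)) *\<^sub>R u) * exp (- (norm u)\<^sup>2 / 2) \<partial>lborel)
    \<longlonglongrightarrow> indicator U x * (\<integral>u. exp (- (norm (u::'a))\<^sup>2 / 2) \<partial>lborel)"
proof -
  have g: "integrable lborel (\<lambda>u::'a. exp (- (norm u)\<^sup>2 / 2))"
    using integrable_norm[OF integrable_gaussian_centred[of 1 "0::'a"]] by (simp add: norm_gaussian)
  have lim: "(\<lambda>n. indicator U (x + (1 / real (Suc n)) *\<^sub>R u) * exp (- (norm u)\<^sup>2 / 2))
      \<longlonglongrightarrow> indicator U x * exp (- (norm u)\<^sup>2 / 2)" for u
  proof (rule tendsto_mult[OF _ tendsto_const])
    have "(\<lambda>n. x + (1 / real (Suc n)) *\<^sub>R u) \<longlonglongrightarrow> x + 0 *\<^sub>R u"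
      by (intro tendsto_intros LIMSEQ_inverse_real_of_nat[unfolded inverse_eq_divide])
    then have l: "(\<lambda>n. x + (1 / real (Suc n)) *\<^sub>R u) \<longlonglongrightarrow> x" by simp
    have "x \<in> interior U \<or> x \<in> interior (- U)"
      using x by (auto simp: frontier_def interior_complement)
    then show "(\<lambda>n. indicator U (x + (1 / real (Suc n)) *\<^sub>R u)) \<longlonglongrightarrow> (indicator U x :: real)"
    proof
      assume i: "x \<in> interior U"
      then have "\<forall>\<^sub>F n in sequentially. x + (1 / real (Suc n)) *\<^sub>R u \<in> interior U"
        using topological_tendstoD[OF l open_interior] by blast
      then have "\<forall>\<^sub>F n in sequentially. indicator U (x + (1 / real (Suc n)) *\<^sub>R u) = (indicator U x :: real)"
        by eventually_elim (use i interior_subset in \<open>auto simp: indicator_def\<close>)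
      then show ?thesis by (rule tendsto_eventually)
    next
      assume i: "x \<in> interior (- U)"
      then have "\<forall>\<^sub>F n in sequentially. x + (1 / real (Suc n)) *\<^sub>R u \<in> interior (- U)"
        using topological_tendstoD[OF l open_interior] by blast
      then have "\<forall>\<^sub>F n in sequentially. indicator U (x + (1 / real (Suc n)) *\<^sub>R u) = (indicator U x :: real)"
        by eventually_elim (use i interior_subset in \<open>auto simp: indicator_def\<close>)
      then show ?thesis by (rule tendsto_eventually)
    qed
  qed
  have "(\<lambda>n. \<integral>u. indicator U (x + (1 / real (Suc n)) *\<^sub>R u) * exp (- (norm u)\<^sup>2 / 2) \<partial>lborel)
    \<longlonglongrightarrow> (\<integral>u. indicator U x * exp (- (norm (u::'a))\<^sup>2 / 2) \<partial>lborel)"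
  proof (rule integral_dominated_convergence[OF _ _ g])
    show "(\<lambda>u. indicator U (x + (1 / real (Suc n)) *\<^sub>R u) * exp (- (norm u)\<^sup>2 / 2)) \<in> borel_measurable lborel" for n
      by measurable
  qed (use lim in \<open>auto simp: indicator_def\<close>)
  then show ?thesis by simp
qed

text \<open>Since \<open>ennreal\<close> sends negative numbers to 0, \<open>P\<close> and
  \<open>Q\<close> have the positive and the negative part of \<open>h\<close> as densities. They
  are finite measures that agree on boxes, an intersection-stable generator of the Borel sets, hence
  they coincide, and so do their densities almost everywhere.\<close>

lemma AE_zero_if_integral_box_zero_real:
  fixes h :: "'a::euclidean_space \<Rightarrow> real"
  assumes h: "integrable lborel h" and z: "\<And>a b. (\<integral>x. indicator (box a b) x * h x \<partial>lborel) = 0"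
  shows "AE x in lborel. h x = 0"
proof -
  have [measurable]: "h \<in> borel_measurable borel"
    using h by (simp add: integrable_iff_bounded)
  define P where "P = density lborel (\<lambda>x. ennreal (h x))"
  define Q where "Q = density lborel (\<lambda>x. ennreal (- h x))"
  have fin: "(\<integral>\<^sup>+x. ennreal (h x) \<partial>lborel) \<noteq> \<infinity>" "(\<integral>\<^sup>+x. ennreal (- h x) \<partial>lborel) \<noteq> \<infinity>"
    using h by (auto simp: real_integrable_def)
  have box: "emeasure P (box a b) = emeasure Q (box a b)" for a b
  proof -
    have i: "integrable lborel (\<lambda>x. indicator (box a b) x * h x)"
      using integrable_mult_indicator[OF _ h, of "box a b"] by simp
    have "emeasure P (box a b) = (\<integral>\<^sup>+x. ennreal (indicator (box a b) x * h x) \<partial>lborel)"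
      unfolding P_def by (subst emeasure_density) (auto intro!: nn_integral_cong simp: indicator_def)
    moreover have "emeasure Q (box a b) = (\<integral>\<^sup>+x. ennreal (- (indicator (box a b) x * h x)) \<partial>lborel)"
      unfolding Q_def by (subst emeasure_density) (auto intro!: nn_integral_cong simp: indicator_def)
    moreover have "(\<integral>\<^sup>+x. ennreal (indicator (box a b) x * h x) \<partial>lborel) \<noteq> \<infinity>"
      "(\<integral>\<^sup>+x. ennreal (- (indicator (box a b) x * h x)) \<partial>lborel) \<noteq> \<infinity>"
      using i by (auto simp: real_integrable_def)
    moreover have "p = q" if "p \<noteq> \<infinity>" "q \<noteq> \<infinity>" "enn2real p = enn2real q" for p q
      using arg_cong[OF that(3), of ennreal] that(1,2) by (simp add: ennreal_enn2real_if)
    ultimately show ?thesis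
      using z[of a b] unfolding real_lebesgue_integral_def[OF i] by simp
  qed
  have "P = Q"
  proof (rule measure_eqI_generator_eq)
    let ?E = "range (\<lambda>(a, b). box a b::'a set)"
    show "Int_stable ?E"
      by (auto simp: Int_stable_def box_Int_box)
    show "?E \<subseteq> Pow UNIV" "sets P = sigma_sets UNIV ?E" "sets Q = sigma_sets UNIV ?E"
      by (simp_all add: borel_eq_box P_def Q_def)
    let ?A = "\<lambda>n::nat. box (- (real n *\<^sub>R One)) (real n *\<^sub>R One) :: 'a set"
    show "range ?A \<subseteq> ?E" "(\<Union>i. ?A i) = UNIV"
      unfolding UN_box_eq_UNIV by auto
    show "emeasure P (?A i) \<noteq> \<infinity>" for i
    proof -
      have "emeasure P (?A i) \<le> emeasure P UNIV"
        by (rule emeasure_mono) (auto simp: P_def)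
      also have "\<dots> < \<infinity>"
        using fin by (simp add: P_def emeasure_density less_top)
      finally show ?thesis by simp
    qed
  qed (auto simp: box)
  then have "AE x in lborel. ennreal (h x) = ennreal (- h x)"
    unfolding P_def Q_def using fin by (intro finite_density_unique[THEN iffD1]) auto
  then show ?thesis
  proof (rule AE_mp, intro AE_I2 impI)
    fix x assume eq: "ennreal (h x) = ennreal (- h x)"
    show "h x = 0"
    proof (cases "h x \<ge> 0")
      case True
      then have "ennreal (- h x) = 0" by (simp add: ennreal_neg)
      with eq True show ?thesis by (simp add: ennreal_eq_0_iff)
    next
      case False
      then have "ennreal (h x) = 0" by (simp add: ennreal_neg)
      with eq False show ?thesis by (metis ennreal_eq_0_iff le_cases neg_le_0_iff_le)
    qed
  qed
qed

lemma AE_zero_if_integral_box_zero: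
  fixes h :: "'a::euclidean_space \<Rightarrow> complex"
  assumes h: "integrable lborel h" and z: "\<And>a b. (\<integral>x. indicator (box a b) x *\<^sub>R h x \<partial>lborel) = 0"
  shows "AE x in lborel. h x = 0"
proof -
  have i: "integrable lborel (\<lambda>x. indicator (box a b) x *\<^sub>R h x)" for a b
    using integrable_mult_indicator[OF _ h, of "box a b"] by simp
  have "AE x in lborel. Re (h x) = 0"
    using integral_Re[OF i] by (intro AE_zero_if_integral_box_zero_real integrable_Re h) (simp add: z)
  moreover have "AE x in lborel. Im (h x) = 0"
    using integral_Im[OF i] by (intro AE_zero_if_integral_box_zero_real integrable_Im h) (simp add: z)
  ultimately show ?thesis
    by eventually_elim (simp add: complex_eq_iff)
qed

text \<open>The bound on \<open>k\<close> lets the integrable function \<open>f x * g y\<close>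
  dominate the whole integrand. Measurability of the kernel is asked in the Borel space of pairs,
  where continuity yields it at once.\<close>

lemma Fubini_bounded_kernel:
  fixes f :: "'a::euclidean_space \<Rightarrow> complex" and g :: "'b::euclidean_space \<Rightarrow> complex"
    and k :: "'a \<Rightarrow> 'b \<Rightarrow> complex"
  assumes f: "integrable lborel f" and g: "integrable lborel g"
    and k: "(\<lambda>p. k (fst p) (snd p)) \<in> borel_measurable borel" and bound: "\<And>x y. norm (k x y) \<le> C"
  shows "(\<integral>x. f x * (\<integral>y. g y * k x y \<partial>lborel) \<partial>lborel) = (\<integral>y. g y * (\<integral>x. f x * k x y \<partial>lborel) \<partial>lborel)"
proof -
  have [measurable]: "f \<in> borel_measurable borel" "g \<in> borel_measurable borel"
    using f g by (simp_all add: integrable_iff_bounded)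
  have [measurable]: "(\<lambda>(x, y). k x y) \<in> borel_measurable (lborel \<Otimes>\<^sub>M lborel)"
    using k by (simp add: case_prod_beta' lborel_prod)
  have fg: "integrable (lborel \<Otimes>\<^sub>M lborel) (\<lambda>(x, y). f x * g y)"
  proof (rule lborel_pair.Fubini_integrable)
    show "integrable lborel (\<lambda>x. \<integral>y. norm (case (x, y) of (x, y) \<Rightarrow> f x * g y) \<partial>lborel)"
      using f by (simp add: norm_mult)
    show "AE x in lborel. integrable lborel (\<lambda>y. case (x, y) of (x, y) \<Rightarrow> f x * g y)"
      using g by simp
  qed measurable
  have int: "integrable (lborel \<Otimes>\<^sub>M lborel) (\<lambda>(x, y). f x * g y * k x y)"
  proof (rule Bochner_Integration.integrable_bound)
    show "integrable (lborel \<Otimes>\<^sub>M lborel) (\<lambda>p. C * (case p of (x, y) \<Rightarrow> norm (f x * g y)))"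
      using integrable_norm[OF fg] by (intro integrable_mult_right) (simp add: case_prod_beta')
    show "AE p in lborel \<Otimes>\<^sub>M lborel. norm (case p of (x, y) \<Rightarrow> f x * g y * k x y)
        \<le> norm (C * (case p of (x, y) \<Rightarrow> norm (f x * g y)))"
    proof (intro AE_I2)
      fix p :: "'a \<times> 'b"
      have "norm (f (fst p) * g (snd p)) * norm (k (fst p) (snd p)) \<le> norm (f (fst p) * g (snd p)) * \<bar>C\<bar>"
        by (intro mult_left_mono order_trans[OF bound]) auto
      then show "norm (case p of (x, y) \<Rightarrow> f x * g y * k x y)
        \<le> norm (C * (case p of (x, y) \<Rightarrow> norm (f x * g y)))"
        by (simp add: case_prod_beta' norm_mult mult_ac)
    qed
  qed measurable
  show "(\<integral>x. f x * (\<integral>y. g y * k x y \<partial>lborel) \<partial>lborel) = (\<integral>y. g y * (\<integral>x. f x * k x y \<partial>lborel) \<partial>lborel)"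
    using lborel_pair.Fubini_integral[OF int, symmetric]
    by (simp add: mult.assoc mult.left_commute flip: integral_mult_right_zero)
qed

text \<open>Averaging the hypothesis over \<^term>\<open>a\<close> in a box and letting \<^term>\<open>t\<close> tend to infinity
  replaces the Gaussian by the indicator function of the box.\<close>

lemma AE_zero_if_gaussian_convolution_zero:
  fixes h :: "'a::euclidean_space \<Rightarrow> complex"
  assumes h: "integrable lborel h"
    and z: "\<And>t a. t > 0 \<Longrightarrow> (\<integral>x. exp (- (t / 2) * (norm (x - a))\<^sup>2) *\<^sub>R h x \<partial>lborel) = 0"
  shows "AE x in lborel. h x = 0"
proof (rule AE_zero_if_integral_box_zero[OF h])
  fix l u :: 'a
  have [measurable]: "h \<in> borel_measurable borel"
    using h by (simp add: integrable_iff_bounded)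
  define U where "U = box l u"
  have [measurable]: "U \<in> sets borel" by (simp add: U_def)
  define G where "G = (\<integral>u. exp (- (norm (u::'a))\<^sup>2 / 2) \<partial>lborel)"
  define k where "k n x = (\<integral>u. indicator U (x + (1 / real (Suc n)) *\<^sub>R u) * exp (- (norm u)\<^sup>2 / 2) \<partial>lborel)"
    for n and x :: 'a
  have g: "integrable lborel (\<lambda>u::'a. exp (- (norm u)\<^sup>2 / 2))"
    using integrable_norm[OF integrable_gaussian_centred[of 1 "0::'a"]] by (simp add: norm_gaussian)
  have "G = Re (\<integral>x. gaussian 1 (0::'a) 0 x \<partial>lborel)"
    unfolding gaussian_0 G_def integral_complex_of_real by simp
  then have G: "G > 0"
    by (simp add: integral_gaussian)
  have U1: "integrable lborel (indicator U :: 'a \<Rightarrow> real)"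
    using emeasure_lborel_box_finite[of l u] by (simp add: U_def integrable_indicator_iff less_top)
  have kz: "(\<integral>x. k n x *\<^sub>R h x \<partial>lborel) = 0" for n
  proof -
    \<comment> \<open>With this \<open>t\<close> the Gaussian has width \<open>1 / Suc n\<close>, so
      the substitution \<open>a = x + u / Suc n\<close> turns its average over centres in
      \<open>U\<close> into \<open>k n x\<close>, up to the Jacobian. Exchanging the integrals then
      makes the hypothesis applicable for each fixed centre.\<close>
    define t where "t = (real (Suc n))\<^sup>2"
    have t: "t > 0" by (simp add: t_def)
    define E where "E x a = exp (- (t / 2) * (norm (x - a))\<^sup>2)" for x a :: 'a
    have [measurable]: "(\<lambda>p. E (fst p) (snd p)) \<in> borel_measurable borel"
      unfolding E_def by (intro borel_measurable_continuous_onI continuous_intros)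
    have E1: "norm (E x a) \<le> 1" for x a
      using t by (simp add: E_def)
    have k_eq: "(\<integral>a. indicator U a * E x a \<partial>lborel) = (1 / real (Suc n)) ^ DIM('a) * k n x" for x
    proof -
      have [measurable]: "E x \<in> borel_measurable borel"
        unfolding E_def by (intro borel_measurable_continuous_onI continuous_intros)
      have "E x (x + (1 / real (Suc n)) *\<^sub>R u) = exp (- (norm u)\<^sup>2 / 2)" for u
        by (simp add: E_def t_def power_divide power_mult_distrib)
      then show ?thesis
        unfolding k_def
        by (subst lborel_integral_affine[where c="1 / real (Suc n)" and a=x]) simp_all
    qed
    have "(\<integral>x. h x * (\<integral>a. of_real (indicator U a) * of_real (E x a) \<partial>lborel) \<partial>lborel)
        = (\<integral>a. of_real (indicator U a) * (\<integral>x. h x * of_real (E x a) \<partial>lborel) \<partial>lborel)"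
    proof (rule Fubini_bounded_kernel[OF h, where C=1])
      show "integrable lborel (\<lambda>a. complex_of_real (indicator U a))"
        using U1 by simp
    qed (use E1 in auto)
    also have "\<dots> = 0"
      using z[OF t] by (simp add: E_def scaleR_conv_of_real mult.commute)
    also have "(\<lambda>x. \<integral>a. of_real (indicator U a) * of_real (E x a) \<partial>lborel)
        = (\<lambda>x. of_real ((1 / real (Suc n)) ^ DIM('a) * k n x) :: complex)"
      by (simp only: of_real_mult[symmetric] integral_complex_of_real k_eq)
    finally show ?thesis
      by (simp add: scaleR_conv_of_real mult.left_commute[of "h _"] mult.commute[of "h _"] mult.assoc del: of_nat_Suc)
  qed
  have "(\<lambda>n. \<integral>x. k n x *\<^sub>R h x \<partial>lborel) \<longlonglongrightarrow> (\<integral>x. (indicator U x * G) *\<^sub>R h x \<partial>lborel)"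
  proof (rule integral_dominated_convergence)
    show "integrable lborel (\<lambda>x. G * norm (h x))"
      using h by simp
    show "AE x in lborel. (\<lambda>n. k n x *\<^sub>R h x) \<longlonglongrightarrow> (indicator U x * G) *\<^sub>R h x"
    proof -
      \<comment> \<open>Pointwise convergence of \<open>k n\<close> fails only on the boundary of
        the box, a null set by convexity.\<close>
      have "frontier U \<in> null_sets lborel"
        using negligible_convex_frontier[OF convex_box(2)[of l u]]
        by (simp add: U_def negligible_iff_null_sets null_sets_completion_iff)
      then have "AE x in lborel. x \<notin> frontier U"
        by (rule AE_not_in)
      then show ?thesis
      proof (rule AE_mp, intro AE_I2 impI)
        fix x assume x: "x \<notin> frontier U"
        show "(\<lambda>n. k n x *\<^sub>R h x) \<longlonglongrightarrow> (indicator U x * G) *\<^sub>R h x"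
          unfolding k_def G_def
          by (intro tendsto_scaleR tendsto_const indicator_box_gaussian_tendsto x) simp
      qed
    qed
    show "(\<lambda>x. k n x *\<^sub>R h x) \<in> borel_measurable lborel" for n
      unfolding k_def by measurable
    show "AE x in lborel. norm (k n x *\<^sub>R h x) \<le> G * norm (h x)" for n
    proof (intro AE_I2)
      fix x
      have "integrable lborel (\<lambda>u. indicator U (x + (1 / real (Suc n)) *\<^sub>R u) * exp (- (norm u)\<^sup>2 / 2))"
        by (rule Bochner_Integration.integrable_bound[OF g]) (auto simp: indicator_def)
      then have "\<bar>k n x\<bar> \<le> G"
        unfolding k_def G_def
        by (intro integral_abs_bound[THEN order_trans] integral_mono integrable_abs g) (auto simp: indicator_def)
      then show "norm (k n x *\<^sub>R h x) \<le> G * norm (h x)"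
        by (auto intro: mult_right_mono)
    qed
  qed auto
  then have "(\<integral>x. (indicator U x * G) *\<^sub>R h x \<partial>lborel) = 0"
    unfolding kz by (simp add: LIMSEQ_const_iff)
  then have "G *\<^sub>R (\<integral>x. indicator U x *\<^sub>R h x \<partial>lborel) = 0"
    by (simp add: mult.commute flip: integral_scaleR_right scaleR_scaleR)
  then show "(\<integral>x. indicator (box l u) x *\<^sub>R h x \<partial>lborel) = 0"
    using G by (simp add: U_def)
qed

text \<open>A square-integrable \<open>f\<close> may fail to be integrable, so it is first
  multiplied by a Gaussian centred at 0. A product of two Gaussians is a constant times another
  Gaussian, so the orthogonality passes on to \<open>h\<close>.\<close>

lemma gaussian_orthogonal_imp_zero:
  fixes f :: "'a::euclidean_space \<Rightarrow> complex"
  assumes f: "square_integrable f"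
    and orth: "\<And>t a. t > 0 \<Longrightarrow> (\<integral>x. f x * cnj (gaussian t a 0 x) \<partial>lborel) = 0"
  shows "AE x in lborel. f x = 0"
proof -
  define h where "h x = exp (- (1 / 2) * (norm x)\<^sup>2) *\<^sub>R f x" for x
  have "AE x in lborel. h x = 0"
  proof (rule AE_zero_if_gaussian_convolution_zero)
    show "integrable lborel h"
      using integrable_mult_square_integrable[OF f square_integrable_gaussian[of 1 0 0]]
      by (simp add: h_def[abs_def] gaussian_0 scaleR_conv_of_real mult.commute)
    fix t :: real and a :: 'a assume t: "t > 0"
    \<comment> \<open>Completing the square: \<open>r *\<^sub>R a\<close> is the mean of the centres
      \<open>a\<close> and 0 with weights \<open>t\<close> and 1, and the product has the total
      weight \<open>1 + t\<close>.\<close>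
    define r where "r = t / (1 + t)"
    have r: "(1 + t) * r = t" using t by (simp add: r_def)
    have "- (t / 2) * (norm (x - a))\<^sup>2 + - (1 / 2) * (norm x)\<^sup>2
        = - (r / 2) * (norm a)\<^sup>2 + - ((1 + t) / 2) * (norm (x - r *\<^sub>R a))\<^sup>2" for x
    proof -
      have 1: "(norm (x - a))\<^sup>2 = (norm x)\<^sup>2 - 2 * (x \<bullet> a) + (norm a)\<^sup>2"
        using norm_diff_scaleR_sq[of x 1 a] by (simp add: power2_norm_eq_inner)
      have "(1 + t) * (norm (x - r *\<^sub>R a))\<^sup>2
          = (1 + t) * (norm x)\<^sup>2 - 2 * (((1 + t) * r) * (x \<bullet> a)) + (((1 + t) * r) * r) * (norm a)\<^sup>2"
        unfolding norm_diff_scaleR_sq power2_norm_eq_inner by (simp add: algebra_simps inner_commute)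
      moreover have "t * r = t - r"
        using r by (simp add: algebra_simps)
      ultimately have 2: "(1 + t) * (norm (x - r *\<^sub>R a))\<^sup>2
          = (1 + t) * (norm x)\<^sup>2 - 2 * (t * (x \<bullet> a)) + (t - r) * (norm a)\<^sup>2"
        unfolding r by simp
      have "- ((1 + t) / 2) * (norm (x - r *\<^sub>R a))\<^sup>2 = - ((1 + t) * (norm (x - r *\<^sub>R a))\<^sup>2) / 2"
        by simp
      then show ?thesis
        unfolding 1 2 by (simp add: field_simps)
    qed
    then have "exp (- (t / 2) * (norm (x - a))\<^sup>2) * exp (- (1 / 2) * (norm x)\<^sup>2)
        = exp (- (r / 2) * (norm a)\<^sup>2) * exp (- ((1 + t) / 2) * (norm (x - r *\<^sub>R a))\<^sup>2)" for x
      unfolding exp_add[symmetric] by simp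
    then have "exp (- (t / 2) * (norm (x - a))\<^sup>2) *\<^sub>R h x
        = of_real (exp (- (r / 2) * (norm a)\<^sup>2)) * (f x * cnj (gaussian (1 + t) (r *\<^sub>R a) 0 x))" for x
      unfolding h_def gaussian_0 scaleR_scaleR by (simp add: scaleR_conv_of_real)
    then show "(\<integral>x. exp (- (t / 2) * (norm (x - a))\<^sup>2) *\<^sub>R h x \<partial>lborel) = 0"
      using orth[of "1 + t" "r *\<^sub>R a"] t by simp
  qed
  then show ?thesis
    by (simp add: h_def)
qed

text \<open>This is the density of the span of the Gaussians in the form in which it is used. The
  vectors on which both operators agree form a closed subspace; were it proper, a nonzero vector
  would be orthogonal to every Gaussian.\<close>

lemma bounded_operator_eqI:
  fixes T1 T2 :: "'a::euclidean_space L2 \<Rightarrow> 'a L2"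
  assumes T: "bounded_operator_L2 T1" "bounded_operator_L2 T2"
    and eq: "\<And>t a. t > 0 \<Longrightarrow> T1 (abs_L2 (gaussian t a 0)) = T2 (abs_L2 (gaussian t a 0))"
  shows "T1 = T2"
proof (rule ccontr)
  define S where "S = {u. T1 u = T2 u}"
  assume "T1 \<noteq> T2"
  then obtain u where u: "u \<notin> S" by (auto simp: S_def)
  interpret T1: bounded_linear T1 using T by (simp add: bounded_operator_L2_def)
  interpret T2: bounded_linear T2 using T by (simp add: bounded_operator_L2_def)
  have "subspace S"
    by (auto simp: S_def subspace_def T1.zero T2.zero T1.add T2.add T1.scaleR T2.scaleR)
  moreover have "closed S"
    unfolding S_def
    by (intro closed_Collect_eq T1.continuous_on T2.continuous_on continuous_on_id)
  ultimately obtain w where w: "w \<noteq> 0" and orth: "\<And>v. v \<in> S \<Longrightarrow> w \<bullet> v = 0"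
    using closed_subspace_orthogonal_vector u by blast
  have corth: "cinner_L2 w v = 0" if "v \<in> S" for v
  proof -
    \<comment> \<open>The inner product of \<open>real_inner\<close> sees only the real part of
      \<open>cinner_L2\<close>; testing against the multiple of \<open>v\<close> by the imaginary
      unit, which stays in \<open>S\<close>, removes the imaginary part as well.\<close>
    have "scaleC_L2 \<i> v \<in> S"
      using that T by (simp add: S_def bounded_operator_L2_def)
    from orth[OF this] orth[OF that] show ?thesis
      by (simp add: inner_L2_def cinner_scaleC_right complex_eq_iff)
  qed
  obtain f where f: "square_integrable f" "w = abs_L2 f"
    by (rule L2_cases)
  have "AE x in lborel. f x = 0"
  proof (rule gaussian_orthogonal_imp_zero[OF f(1)])
    fix t :: real and a :: 'a assume t: "t > 0"
    then have "abs_L2 (gaussian t a 0) \<in> S" by (simp add: S_def eq)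
    from corth[OF this] show "(\<integral>x. f x * cnj (gaussian t a 0 x) \<partial>lborel) = 0"
      by (simp add: f cinner_abs_L2 square_integrable_gaussian t)
  qed
  then have "w = 0"
    unfolding f(2) zero_L2_def by (simp add: abs_L2_eq_iff f square_integrable_zero)
  with w show False ..
qed

subsection \<open>The Fourier transform\<close>

text \<open>The transform is unnormalised. The sign \<open>s\<close>, later constrained by
  \<open>s\<^sup>2 = 1\<close>, lets the transform and its conjugate be treated together.\<close>

definition fourier :: "real \<Rightarrow> ('a::euclidean_space \<Rightarrow> complex) \<Rightarrow> 'a \<Rightarrow> complex" where
  "fourier s f \<xi> = (\<integral>x. iexp (s * (\<xi> \<bullet> x)) * f x \<partial>lborel)"

lemma fourier_gaussian:
  fixes a b :: "'a::euclidean_space"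
  assumes "t > 0" and s: "s\<^sup>2 = 1"
  shows "fourier s (gaussian t a b) \<xi>
    = (of_real (sqrt (2 * pi / t) ^ DIM('a)) * iexp (a \<bullet> b)) * gaussian (1 / t) (- s *\<^sub>R b) (s *\<^sub>R a) \<xi>"
proof -
  have "iexp (s * (\<xi> \<bullet> x)) * gaussian t a b x = gaussian t a (b + s *\<^sub>R \<xi>) x" for x
    by (simp add: gaussian_def inner_add_left exp_add[symmetric] algebra_simps)
  \<comment> \<open>For \<open>s = 1\<close> and \<open>s = -1\<close> alike, the quadratic exponent
    in the shifted frequency is a Gaussian in the dual variable, now centred at
    \<open>- s *\<^sub>R b\<close>.\<close>
  moreover have "(norm (\<xi> + s *\<^sub>R b))\<^sup>2 = (norm (b + s *\<^sub>R \<xi>))\<^sup>2"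
    using s by (auto simp: power2_eq_1_iff add.commute norm_minus_commute)
  ultimately show ?thesis
    unfolding fourier_def
    by (simp add: integral_gaussian[OF assms(1)] gaussian_eq_mult[of "1/t"] inner_simps exp_add algebra_simps)
qed


section \<open>The sharp norm bound for integrable square-integrable functions\<close>

lemma ennreal_norm_integral_le:
  fixes f :: "'a \<Rightarrow> 'b::{banach, second_countable_topology}"
  shows "ennreal (norm (integral\<^sup>L M f)) \<le> (\<integral>\<^sup>+x. ennreal (norm (f x)) \<partial>M)"
  \<comment> \<open>The Bochner integral of a non-integrable function is 0 by convention, so the
    bound is trivial in that case.\<close>
  by (cases "integrable M f") (simp_all add: integral_norm_bound_ennreal not_integrable_integral_eq)

lemma fourier_measurable [measurable]:
  fixes f :: "'a::euclidean_space \<Rightarrow> complex"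
  assumes [measurable]: "f \<in> borel_measurable borel"
  shows "fourier s f \<in> borel_measurable borel"
  unfolding fourier_def by measurable

lemma norm_fourier_le: "norm (fourier s f \<xi>) \<le> (\<integral>x. norm (f x) \<partial>lborel)"
  unfolding fourier_def by (rule integral_norm_bound[THEN order_trans]) (simp add: norm_mult)

lemma iexp_kernel_measurable:
  "(\<lambda>p::'a::euclidean_space \<times> 'a. iexp (s * (fst p \<bullet> snd p))) \<in> borel_measurable borel"
  by (intro borel_measurable_continuous_onI continuous_intros)

lemma sqrt_two_pi_mult:
  assumes "t > 0"
  shows "sqrt (2 * pi / t) * sqrt (2 * pi * t) = 2 * pi"
proof -
  have "(2 * pi / t) * (2 * pi * t) = (2 * pi)\<^sup>2"
    using assms by (simp add: power2_eq_square)
  then show ?thesis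
    unfolding real_sqrt_mult[symmetric] by (simp only: real_sqrt_abs) simp
qed

text \<open>The factors \<open>sqrt (2 * pi / e)\<close> and \<open>sqrt (2 * pi * e)\<close>
  multiply to \<open>2 * pi\<close>, so the mass does not depend on \<open>e\<close>. This is the
  source of the constant in Plancherel's theorem.\<close>

lemma heat_kernel_integral:
  fixes y :: "'a::euclidean_space"
  assumes "e > 0"
  shows "(\<integral>\<^sup>+z. ennreal (sqrt (2 * pi / e) ^ DIM('a) * exp (- (norm (y - z))\<^sup>2 / (2 * e))) \<partial>lborel)
    = ennreal ((2 * pi) ^ DIM('a))"
proof -
  let ?K = "\<lambda>z. sqrt (2 * pi / e) ^ DIM('a) * exp (- (norm (y - z))\<^sup>2 / (2 * e))"
  have eq: "?K z = sqrt (2 * pi / e) ^ DIM('a) * norm (gaussian (1 / e) y 0 z)" for z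
    by (simp add: norm_gaussian norm_minus_commute)
  have i: "integrable lborel ?K"
    unfolding eq using integrable_gaussian[of "1/e" y 0] assms by (intro integrable_mult_right) auto
  have "complex_of_real (\<integral>z. norm (gaussian (1 / e) y 0 z) \<partial>lborel) = (\<integral>z. gaussian (1 / e) y 0 z \<partial>lborel)"
    unfolding integral_complex_of_real[symmetric] by (simp add: gaussian_0 norm_gaussian)
  also have "\<dots> = of_real (sqrt (2 * pi * e) ^ DIM('a))"
    using assms by (simp add: integral_gaussian)
  finally have "(\<integral>z. norm (gaussian (1 / e) y 0 z) \<partial>lborel) = sqrt (2 * pi * e) ^ DIM('a)"
    unfolding of_real_eq_iff .
  then have "(\<integral>z. ?K z \<partial>lborel) = (sqrt (2 * pi / e) * sqrt (2 * pi * e)) ^ DIM('a)"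
    unfolding eq by (simp add: power_mult_distrib)
  also have "sqrt (2 * pi / e) * sqrt (2 * pi * e) = 2 * pi"
    by (rule sqrt_two_pi_mult[OF assms])
  finally have "(\<integral>z. ?K z \<partial>lborel) = (2 * pi) ^ DIM('a)" .
  with i assms show ?thesis
    by (subst nn_integral_eq_integral[OF i]) (auto simp del: integral_mult_right_zero)
qed

context
  fixes f :: "'a::euclidean_space \<Rightarrow> complex" and s :: real
  assumes f: "integrable lborel f" and sq: "square_integrable f" and s: "s\<^sup>2 = 1"
begin

text \<open>The damping factor makes Fubini's theorem applicable; the right-hand side is then estimated by
  the arithmetic-geometric mean inequality, with the sharp constant.\<close>

lemma fourier_damped_eq:
  assumes e: "e > 0"
  shows "(\<integral>\<xi>. of_real (exp (- (e / 2) * (norm \<xi>)\<^sup>2) * (norm (fourier s f \<xi>))\<^sup>2) \<partial>lborel)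
    = (\<integral>y. f y * (\<integral>z. cnj (f z) * of_real (sqrt (2 * pi / e) ^ DIM('a) * exp (- (norm (y - z))\<^sup>2 / (2 * e))) \<partial>lborel) \<partial>lborel)"
proof -
  define w where "w = gaussian e 0 (0::'a)"
  have w: "integrable lborel w" "norm (w \<xi>) \<le> 1" for \<xi>
    using e by (simp_all add: w_def integrable_gaussian norm_gaussian)
  have [measurable]: "f \<in> borel_measurable borel" "w \<in> borel_measurable borel"
    using sq by (simp_all add: square_integrable_def w_def)
  have [measurable]: "cnj \<in> borel_measurable borel"
    by (intro borel_measurable_continuous_onI continuous_intros)
  let ?F = "fourier s f"
  have bound: "norm (?F \<xi>) \<le> (\<integral>x. norm (f x) \<partial>lborel)" for \<xi>
    by (rule norm_fourier_le)
  \<comment> \<open>No integrability of the transform is known yet; its boundedness by the L1 norm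
    of \<open>f\<close>, together with the integrable damping factor \<open>w\<close>, suffices for
    Fubini's theorem.\<close>
  have wF: "integrable lborel (\<lambda>\<xi>. w \<xi> * cnj (?F \<xi>))"
  proof (rule Bochner_Integration.integrable_bound)
    show "integrable lborel (\<lambda>\<xi>. (\<integral>x. norm (f x) \<partial>lborel) *\<^sub>R w \<xi>)"
      using w by simp
    show "AE \<xi> in lborel. norm (w \<xi> * cnj (?F \<xi>)) \<le> norm ((\<integral>x. norm (f x) \<partial>lborel) *\<^sub>R w \<xi>)"
      using bound by (intro AE_I2) (auto simp: norm_mult mult.commute intro!: mult_left_mono bound)
  qed measurable
  have we: "integrable lborel (\<lambda>\<xi>. w \<xi> * iexp (s * (\<xi> \<bullet> y)))" for y
    by (rule Bochner_Integration.integrable_bound[OF w(1)]) (auto simp: norm_mult)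
  have cf: "integrable lborel (\<lambda>z. cnj (f z))"
    using f by simp
  have "(\<integral>\<xi>. of_real (exp (- (e / 2) * (norm \<xi>)\<^sup>2) * (norm (?F \<xi>))\<^sup>2) \<partial>lborel)
      = (\<integral>\<xi>. (w \<xi> * cnj (?F \<xi>)) * (\<integral>y. f y * iexp (s * (\<xi> \<bullet> y)) \<partial>lborel) \<partial>lborel)"
  proof (intro Bochner_Integration.integral_cong refl)
    fix \<xi>
    have "(\<integral>y. f y * iexp (s * (\<xi> \<bullet> y)) \<partial>lborel) = ?F \<xi>"
      unfolding fourier_def by (simp only: mult.commute)
    then show "of_real (exp (- (e / 2) * (norm \<xi>)\<^sup>2) * (norm (?F \<xi>))\<^sup>2)
        = (w \<xi> * cnj (?F \<xi>)) * (\<integral>y. f y * iexp (s * (\<xi> \<bullet> y)) \<partial>lborel)"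
      unfolding of_real_mult complex_norm_square w_def gaussian_0 by (simp only: diff_zero mult_ac)
  qed
  \<comment> \<open>The squared modulus is opened one factor at a time: this exchange unfolds the
    transform, the next one its conjugate. The integral over the frequency that remains is that of a
    modulated Gaussian and yields the heat kernel in \<open>y - z\<close>.\<close>
  also have "\<dots> = (\<integral>y. f y * (\<integral>\<xi>. (w \<xi> * cnj (?F \<xi>)) * iexp (s * (\<xi> \<bullet> y)) \<partial>lborel) \<partial>lborel)"
    by (rule Fubini_bounded_kernel[OF wF f iexp_kernel_measurable, where C=1]) simp
  also have "\<dots> = (\<integral>y. f y * (\<integral>z. cnj (f z) *
      of_real (sqrt (2 * pi / e) ^ DIM('a) * exp (- (norm (y - z))\<^sup>2 / (2 * e))) \<partial>lborel) \<partial>lborel)"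
  proof (rule Bochner_Integration.integral_cong[OF refl], rule arg_cong2[where f="(*)", OF refl])
    fix y
    have cF: "cnj (?F \<xi>) = (\<integral>z. cnj (f z) * iexp ((- s) * (\<xi> \<bullet> z)) \<partial>lborel)" for \<xi>
      unfolding fourier_def by (simp add: mult.commute exp_cnj flip: Bochner_Integration.integral_cnj)
    have "(\<integral>\<xi>. (w \<xi> * cnj (?F \<xi>)) * iexp (s * (\<xi> \<bullet> y)) \<partial>lborel)
        = (\<integral>\<xi>. (w \<xi> * iexp (s * (\<xi> \<bullet> y))) * (\<integral>z. cnj (f z) * iexp ((- s) * (\<xi> \<bullet> z)) \<partial>lborel) \<partial>lborel)"
      unfolding cF by (simp only: mult_ac)
    also have "\<dots> = (\<integral>z. cnj (f z) * (\<integral>\<xi>. (w \<xi> * iexp (s * (\<xi> \<bullet> y))) * iexp ((- s) * (\<xi> \<bullet> z)) \<partial>lborel) \<partial>lborel)"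
      by (rule Fubini_bounded_kernel[OF we cf iexp_kernel_measurable, where C=1]) simp
    also have "\<dots> = (\<integral>z. cnj (f z) *
      of_real (sqrt (2 * pi / e) ^ DIM('a) * exp (- (norm (y - z))\<^sup>2 / (2 * e))) \<partial>lborel)"
    proof (intro Bochner_Integration.integral_cong refl arg_cong2[where f="(*)"])
      fix z
      have "(w \<xi> * iexp (s * (\<xi> \<bullet> y))) * iexp ((- s) * (\<xi> \<bullet> z)) = gaussian e 0 (s *\<^sub>R (y - z)) \<xi>" for \<xi>
        by (simp add: w_def gaussian_def inner_diff_left exp_add[symmetric] algebra_simps inner_commute)
      moreover have "norm (s *\<^sub>R (y - z)) = norm (y - z)"
        using s by (auto simp: power2_eq_1_iff norm_minus_commute)
      ultimately show "(\<integral>\<xi>. (w \<xi> * iexp (s * (\<xi> \<bullet> y))) * iexp ((- s) * (\<xi> \<bullet> z)) \<partial>lborel)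
          = of_real (sqrt (2 * pi / e) ^ DIM('a) * exp (- (norm (y - z))\<^sup>2 / (2 * e)))"
        by (simp only: integral_gaussian[OF e]) simp
    qed
    finally show "(\<integral>\<xi>. (w \<xi> * cnj (?F \<xi>)) * iexp (s * (\<xi> \<bullet> y)) \<partial>lborel) = (\<integral>z. cnj (f z) *
      of_real (sqrt (2 * pi / e) ^ DIM('a) * exp (- (norm (y - z))\<^sup>2 / (2 * e))) \<partial>lborel)" .
  qed
  finally show ?thesis .
qed

text \<open>This is Schur's test for the symmetric kernel \<open>K\<close>: both of its marginals
  are the constant \<open>(2 * pi) ^ n\<close>, so the two halves of the arithmetic-geometric mean
  contribute equally and the constant is uniform in \<open>e\<close>.\<close>

lemma fourier_damped_le:
  assumes e: "e > 0"
  shows "(\<integral>\<^sup>+\<xi>. ennreal (exp (- (e / 2) * (norm \<xi>)\<^sup>2) * (norm (fourier s f \<xi>))\<^sup>2) \<partial>lborel)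
    \<le> ennreal ((2 * pi) ^ DIM('a)) * (\<integral>\<^sup>+y. ennreal ((norm (f y))\<^sup>2) \<partial>lborel)"
proof -
  have [measurable]: "f \<in> borel_measurable borel"
    using sq by (simp add: square_integrable_def)
  define K where "K y z = sqrt (2 * pi / e) ^ DIM('a) * exp (- (norm (y - z))\<^sup>2 / (2 * e))" for y z :: 'a
  have K0: "0 \<le> K y z" for y z
    using e by (simp add: K_def)
  have Ksym: "K y z = K z y" for y z
    by (simp add: K_def norm_minus_commute)
  have [measurable]: "(\<lambda>(y, z). K y z) \<in> borel_measurable (lborel \<Otimes>\<^sub>M lborel)"
    unfolding K_def lborel_prod case_prod_beta' measurable_lborel2
    by (intro borel_measurable_continuous_onI continuous_intros) (use e in auto)
  have Ki: "(\<integral>\<^sup>+z. ennreal (K y z) \<partial>lborel) = ennreal ((2 * pi) ^ DIM('a))" for y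
    unfolding K_def by (rule heat_kernel_integral[OF e])
  let ?N = "\<integral>\<^sup>+y. ennreal ((norm (f y))\<^sup>2) \<partial>lborel"
  have half1: "(\<integral>\<^sup>+y. \<integral>\<^sup>+z. ennreal ((norm (f y))\<^sup>2 * K y z) \<partial>lborel \<partial>lborel)
      = ennreal ((2 * pi) ^ DIM('a)) * ?N"
    by (simp add: ennreal_mult K0 nn_integral_cmult Ki nn_integral_multc mult.commute)
  have half2: "(\<integral>\<^sup>+y. \<integral>\<^sup>+z. ennreal ((norm (f z))\<^sup>2 * K y z) \<partial>lborel \<partial>lborel)
      = ennreal ((2 * pi) ^ DIM('a)) * ?N"
    unfolding half1[symmetric] by (subst lborel_pair.Fubini') (simp_all add: Ksym)
  let ?h = "\<lambda>\<xi>. exp (- (e / 2) * (norm \<xi>)\<^sup>2) * (norm (fourier s f \<xi>))\<^sup>2"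
  have int: "integrable lborel ?h"
  proof (rule Bochner_Integration.integrable_bound)
    show "integrable lborel (\<lambda>\<xi>. (\<integral>x. norm (f x) \<partial>lborel)\<^sup>2 *\<^sub>R norm (gaussian e (0::'a) 0 \<xi>))"
      using integrable_norm[OF integrable_gaussian[OF e, of "0::'a" 0]] by simp
    show "AE \<xi> in lborel. norm (?h \<xi>) \<le> norm ((\<integral>x. norm (f x) \<partial>lborel)\<^sup>2 *\<^sub>R norm (gaussian e (0::'a) 0 \<xi>))"
      by (auto simp: norm_gaussian mult.commute intro!: AE_I2 mult_right_mono power_mono norm_fourier_le)
  qed measurable
  have "(\<integral>\<^sup>+\<xi>. ennreal (?h \<xi>) \<partial>lborel) = ennreal (\<integral>\<xi>. ?h \<xi> \<partial>lborel)"
    by (rule nn_integral_eq_integral[OF int]) auto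
  also have "\<dots> \<le> ennreal (norm (\<integral>\<xi>. of_real (?h \<xi>) \<partial>lborel :: complex))"
    unfolding integral_complex_of_real by (intro ennreal_leI) auto
  also have "(\<integral>\<xi>. of_real (?h \<xi>) \<partial>lborel :: complex)
      = (\<integral>y. f y * (\<integral>z. cnj (f z) * of_real (K y z) \<partial>lborel) \<partial>lborel)"
    unfolding K_def by (rule fourier_damped_eq[OF e])
  also have "ennreal (norm \<dots>) \<le> (\<integral>\<^sup>+y. ennreal (norm (f y * (\<integral>z. cnj (f z) * of_real (K y z) \<partial>lborel))) \<partial>lborel)"
    by (rule ennreal_norm_integral_le)
  also have "\<dots> \<le> (\<integral>\<^sup>+y. \<integral>\<^sup>+z. ennreal ((norm (f y))\<^sup>2 * K y z) / 2 + ennreal ((norm (f z))\<^sup>2 * K y z) / 2 \<partial>lborel \<partial>lborel)"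
  proof (rule nn_integral_mono)
    fix y
    have "ennreal (norm (f y * (\<integral>z. cnj (f z) * of_real (K y z) \<partial>lborel)))
        \<le> ennreal (norm (f y)) * (\<integral>\<^sup>+z. ennreal (norm (cnj (f z) * of_real (K y z))) \<partial>lborel)"
      unfolding norm_mult by (simp add: ennreal_mult) (intro mult_left_mono ennreal_norm_integral_le[THEN order_trans], auto simp: norm_mult ennreal_mult)
    also have "\<dots> = (\<integral>\<^sup>+z. ennreal (norm (f y) * norm (f z) * K y z) \<partial>lborel)"
      by (subst nn_integral_cmult[symmetric]) (auto simp: norm_mult ennreal_mult K0 mult_ac)
    also have "\<dots> \<le> (\<integral>\<^sup>+z. ennreal ((norm (f y))\<^sup>2 * K y z) / 2 + ennreal ((norm (f z))\<^sup>2 * K y z) / 2 \<partial>lborel)"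
    proof (rule nn_integral_mono)
      fix z
      have "norm (f y) * norm (f z) \<le> ((norm (f y))\<^sup>2 + (norm (f z))\<^sup>2) / 2"
        using sum_squares_bound[of "norm (f y)" "norm (f z)"] by simp
      then have "norm (f y) * norm (f z) * K y z \<le> ((norm (f y))\<^sup>2 + (norm (f z))\<^sup>2) / 2 * K y z"
        by (rule mult_right_mono[OF _ K0])
      then show "ennreal (norm (f y) * norm (f z) * K y z)
          \<le> ennreal ((norm (f y))\<^sup>2 * K y z) / 2 + ennreal ((norm (f z))\<^sup>2 * K y z) / 2"
        by (simp add: K0 ennreal_leI divide_ennreal[of _ 2, simplified] flip: ennreal_plus) (simp add: algebra_simps add_divide_distrib)
    qed
    finally show "ennreal (norm (f y * (\<integral>z. cnj (f z) * of_real (K y z) \<partial>lborel)))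
      \<le> (\<integral>\<^sup>+z. ennreal ((norm (f y))\<^sup>2 * K y z) / 2 + ennreal ((norm (f z))\<^sup>2 * K y z) / 2 \<partial>lborel)" .
  qed
  also have "\<dots> = ennreal ((2 * pi) ^ DIM('a)) * ?N / 2 + ennreal ((2 * pi) ^ DIM('a)) * ?N / 2"
    by (simp add: nn_integral_add nn_integral_divide half1 half2)
  also have "\<dots> = ennreal ((2 * pi) ^ DIM('a)) * ?N"
  proof -
    have "x / 2 + x / 2 = x" for x :: ennreal
      by (subst add_divide_distrib_ennreal[symmetric], subst mult_2_right[symmetric], rule mult_divide_eq_ennreal) auto
    then show ?thesis .
  qed
  finally show ?thesis .
qed

text \<open>Fatou's lemma along the damping parameters \<open>1 / Suc n\<close>. Extended
  nonnegative integrals are used because finiteness of the left-hand side is itself a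
  consequence.\<close>

lemma nn_integral_fourier_le:
  "(\<integral>\<^sup>+\<xi>. ennreal ((norm (fourier s f \<xi>))\<^sup>2) \<partial>lborel)
    \<le> ennreal ((2 * pi) ^ DIM('a)) * (\<integral>\<^sup>+y. ennreal ((norm (f y))\<^sup>2) \<partial>lborel)"
proof -
  have [measurable]: "f \<in> borel_measurable borel"
    using sq by (simp add: square_integrable_def)
  let ?h = "\<lambda>n \<xi>. exp (- (1 / real (Suc n) / 2) * (norm \<xi>)\<^sup>2) * (norm (fourier s f \<xi>))\<^sup>2"
  have "(\<lambda>n. ?h n \<xi>) \<longlonglongrightarrow> exp (- (0 / 2) * (norm \<xi>)\<^sup>2) * (norm (fourier s f \<xi>))\<^sup>2" for \<xi>
    by (intro tendsto_intros LIMSEQ_inverse_real_of_nat[unfolded inverse_eq_divide]) auto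
  then have "ennreal ((norm (fourier s f \<xi>))\<^sup>2) = liminf (\<lambda>n. ennreal (?h n \<xi>))" for \<xi>
    by (intro lim_imp_Liminf[symmetric]) (auto intro!: tendsto_ennrealI)
  then have "(\<integral>\<^sup>+\<xi>. ennreal ((norm (fourier s f \<xi>))\<^sup>2) \<partial>lborel) = (\<integral>\<^sup>+\<xi>. liminf (\<lambda>n. ennreal (?h n \<xi>)) \<partial>lborel)"
    by simp
  also have "\<dots> \<le> liminf (\<lambda>n. \<integral>\<^sup>+\<xi>. ennreal (?h n \<xi>) \<partial>lborel)"
    by (rule nn_integral_liminf) measurable
  also have "\<dots> \<le> ennreal ((2 * pi) ^ DIM('a)) * (\<integral>\<^sup>+y. ennreal ((norm (f y))\<^sup>2) \<partial>lborel)"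
    by (rule Liminf_le) (simp, intro always_eventually allI fourier_damped_le, simp)
  finally show ?thesis .
qed

lemma square_integrable_fourier: "square_integrable (fourier s f)"
proof (rule square_integrableI_nn)
  show "fourier s f \<in> borel_measurable borel"
    using sq by (intro fourier_measurable) (simp add: square_integrable_def)
  have "ennreal ((2 * pi) ^ DIM('a)) * (\<integral>\<^sup>+y. ennreal ((norm (f y))\<^sup>2) \<partial>lborel) < \<infinity>"
    by (simp add: nn_integral_norm_abs_L2[OF sq] ennreal_mult_less_top)
  then show "(\<integral>\<^sup>+x. ennreal ((norm (fourier s f x))\<^sup>2) \<partial>lborel) < \<infinity>"
    using nn_integral_fourier_le by (rule order.strict_trans1[rotated])
qed

lemma norm_fourier_L2_le:
  "norm (abs_L2 (fourier s f)) \<le> sqrt ((2 * pi) ^ DIM('a)) * norm (abs_L2 f)"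
proof (rule norm_abs_L2_leI[OF square_integrable_fourier])
  show "(\<integral>\<^sup>+x. ennreal ((norm (fourier s f x))\<^sup>2) \<partial>lborel)
      \<le> ennreal ((sqrt ((2 * pi) ^ DIM('a)) * norm (abs_L2 f))\<^sup>2)"
    using nn_integral_fourier_le
    by (simp add: nn_integral_norm_abs_L2[OF sq] power_mult_distrib ennreal_mult real_sqrt_pow2)
qed auto

end

section \<open>Extension of the Fourier transform to L2\<close>

definition truncation :: "nat \<Rightarrow> ('a::euclidean_space \<Rightarrow> complex) \<Rightarrow> 'a \<Rightarrow> complex" where
  "truncation n f x = f x * indicator (cball 0 (real n)) x"

lemma square_integrable_truncation:
  fixes f :: "'a::euclidean_space \<Rightarrow> complex"
  assumes "square_integrable f"
  shows "square_integrable (truncation n f)"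
proof (rule square_integrable_norm_le[OF assms])
  have [measurable]: "f \<in> borel_measurable borel" "cball (0::'a) (real n) \<in> sets borel"
    using assms by (simp_all add: square_integrable_def)
  show "truncation n f \<in> borel_measurable borel"
    unfolding truncation_def[abs_def] by measurable
qed (simp add: truncation_def indicator_def)

text \<open>A ball has finite measure, so its indicator function is square-integrable and the
  truncation is a product of two square-integrable functions.\<close>

lemma integrable_truncation:
  fixes f :: "'a::euclidean_space \<Rightarrow> complex"
  assumes "square_integrable f"
  shows "integrable lborel (truncation n f)"
proof -
  have "integrable lborel (indicator (cball (0::'a) (real n)) :: 'a \<Rightarrow> real)"
    using emeasure_lborel_cball_finite[of "0::'a" "real n"] by (simp add: integrable_indicator_iff less_top)
  moreover have "(norm (indicator (cball 0 (real n)) x :: complex))\<^sup>2 = indicator (cball 0 (real n)) x" for x :: 'a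
    by (simp add: indicator_def)
  ultimately have "square_integrable (indicator (cball (0::'a) (real n)) :: 'a \<Rightarrow> complex)"
    unfolding square_integrable_def by (auto intro!: borel_measurable_indicator)
  note sqi = this
  have c: "cnj (indicator S x) = indicator S x" for S and x :: 'a
    by (simp add: indicator_def)
  from integrable_mult_square_integrable[OF assms sqi]
  show ?thesis unfolding c truncation_def[abs_def] .
qed

lemma truncation_tendsto:
  fixes f :: "'a::euclidean_space \<Rightarrow> complex"
  assumes sq: "square_integrable f"
  shows "(\<lambda>n. abs_L2 (truncation n f)) \<longlonglongrightarrow> abs_L2 f"
proof -
  have [measurable]: "f \<in> borel_measurable borel" "truncation n f \<in> borel_measurable borel" for n
    using sq square_integrable_truncation[OF sq] by (auto simp: square_integrable_def)
  have "(\<lambda>n. \<integral>x. (norm (truncation n f x - f x))\<^sup>2 \<partial>lborel) \<longlonglongrightarrow> (\<integral>x. 0 \<partial>(lborel :: 'a measure))"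
  proof (rule integral_dominated_convergence)
    show "integrable lborel (\<lambda>x. (norm (f x))\<^sup>2)"
      using sq by (simp add: square_integrable_def)
    show "AE x in lborel. (\<lambda>n. (norm (truncation n f x - f x))\<^sup>2) \<longlonglongrightarrow> 0"
    proof (intro AE_I2 tendsto_eventually)
      fix x :: 'a
      show "\<forall>\<^sub>F n in sequentially. (norm (truncation n f x - f x))\<^sup>2 = 0"
        using eventually_ge_at_top[of "nat \<lceil>norm x\<rceil>"]
        by eventually_elim (auto simp: truncation_def indicator_def nat_le_iff ceiling_le_iff)
    qed
  qed (auto simp: truncation_def indicator_def)
  moreover have "(\<integral>x. (norm (truncation n f x - f x))\<^sup>2 \<partial>lborel) = (norm (abs_L2 (truncation n f) - abs_L2 f))\<^sup>2" for n
    by (simp add: abs_L2_diff norm_abs_L2_sq square_integrable_diff square_integrable_truncation sq)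
  ultimately have "(\<lambda>n. (norm (abs_L2 (truncation n f) - abs_L2 f))\<^sup>2) \<longlonglongrightarrow> 0"
    by simp
  from tendsto_real_sqrt[OF this] have "(\<lambda>n. norm (abs_L2 (truncation n f) - abs_L2 f)) \<longlonglongrightarrow> 0"
    by simp
  then show ?thesis
    by (simp add: tendsto_norm_zero_iff LIM_zero_iff)
qed

lemma integrable_fourier_integrand:
  fixes f :: "'a::euclidean_space \<Rightarrow> complex"
  assumes f: "integrable lborel f"
  shows "integrable lborel (\<lambda>x. iexp (s * (\<xi> \<bullet> x)) * f x)"
proof (rule Bochner_Integration.integrable_bound[OF f])
  have [measurable]: "f \<in> borel_measurable borel"
    using f by (simp add: integrable_iff_bounded)
  show "(\<lambda>x. iexp (s * (\<xi> \<bullet> x)) * f x) \<in> borel_measurable lborel"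
    by measurable
qed (simp add: norm_mult)

lemma fourier_add:
  "integrable lborel f \<Longrightarrow> integrable lborel g \<Longrightarrow> fourier s (\<lambda>x. f x + g x) \<xi> = fourier s f \<xi> + fourier s g \<xi>"
  unfolding fourier_def distrib_left by (intro Bochner_Integration.integral_add integrable_fourier_integrand)

lemma fourier_diff:
  "integrable lborel f \<Longrightarrow> integrable lborel g \<Longrightarrow> fourier s (\<lambda>x. f x - g x) \<xi> = fourier s f \<xi> - fourier s g \<xi>"
  unfolding fourier_def right_diff_distrib by (intro Bochner_Integration.integral_diff integrable_fourier_integrand)

lemma fourier_cmult: "fourier s (\<lambda>x. c * f x) \<xi> = c * fourier s f \<xi>"
  unfolding fourier_def by (simp add: mult.left_commute)

text \<open>The limit exists when \<open>s\<^sup>2 = 1\<close>, and it does not depend on the chosen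
  representative or on cutting off to balls; \<open>fourier_L2_tendsto\<close> establishes
  both.\<close>

definition fourier_L2 :: "real \<Rightarrow> 'a::euclidean_space L2 \<Rightarrow> 'a L2" where
  "fourier_L2 s u = lim (\<lambda>n. abs_L2 (fourier s (truncation n (rep_L2 u))))"

text \<open>For positive \<open>k\<close> this is \<open>k\<close> times a unitary operator. Stating
  it by norms makes the factors multiply under composition; inner products are recovered by
  polarization.\<close>

definition scaled_unitary :: "real \<Rightarrow> ('a::euclidean_space L2 \<Rightarrow> 'a L2) \<Rightarrow> bool" where
  "scaled_unitary k T \<longleftrightarrow> bounded_operator_L2 T \<and> surj T \<and> (\<forall>u. norm (T u) = k * norm u)"

lemma bounded_operator_L2I:
  assumes "\<And>u v. T (u + v) = T u + T v" "\<And>c u. T (scaleC_L2 c u) = scaleC_L2 c (T u)"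
    and "\<And>u. norm (T u) \<le> K * norm u"
  shows "bounded_operator_L2 T"
  unfolding bounded_operator_L2_def
proof
  show "bounded_linear T"
    by (rule bounded_linear_intro[of _ K]) (use assms in \<open>simp_all add: scaleR_L2_eq_scaleC mult.commute\<close>)
qed (use assms in simp)

lemma bounded_operator_compose:
  "bounded_operator_L2 S \<Longrightarrow> bounded_operator_L2 T \<Longrightarrow> bounded_operator_L2 (\<lambda>u. S (T u))"
  by (auto simp: bounded_operator_L2_def intro: bounded_linear_compose)

lemma bounded_operator_scaleC: "bounded_operator_L2 (scaleC_L2 c)"
  by (rule bounded_operator_L2I[of _ "cmod c"]) (simp_all add: norm_scaleC_L2 mult.commute)

lemma scaled_unitary_compose:
  assumes "scaled_unitary k S" "scaled_unitary l T"
  shows "scaled_unitary (k * l) (\<lambda>u. S (T u))"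
  using assms comp_surj[of T S] unfolding scaled_unitary_def
  by (auto simp: comp_def intro: bounded_operator_compose)

text \<open>Real polarization gives the real part. Since \<open>T\<close> is complex linear,
  replacing \<open>v\<close> by its multiple by the imaginary unit gives the imaginary part.\<close>

lemma cinner_scaled_unitary:
  assumes T: "scaled_unitary k T"
  shows "cinner_L2 (T u) (T v) = of_real (k\<^sup>2) * cinner_L2 u v"
proof -
  interpret bounded_linear T
    using T by (simp add: scaled_unitary_def bounded_operator_L2_def)
  have sc: "T (scaleC_L2 c u) = scaleC_L2 c (T u)" and n: "norm (T u) = k * norm u" for c u
    using T by (auto simp: scaled_unitary_def bounded_operator_L2_def)
  have re: "T u \<bullet> T v = k\<^sup>2 * (u \<bullet> v)" for u v
    unfolding dot_norm add[symmetric] n power_mult_distrib by (simp add: algebra_simps diff_divide_distrib add_divide_distrib)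
  from re[of u v] re[of u "scaleC_L2 \<i> v"] show ?thesis
    by (simp add: inner_L2_def sc cinner_scaleC_right complex_eq_iff)
qed

lemma unitary_scaleC_scaled_unitary_iff:
  assumes T: "scaled_unitary k T" and k: "k > 0"
  shows "unitary_L2 (\<lambda>u. scaleC_L2 c (T u)) \<longleftrightarrow> cmod c * k = 1"
proof
  assume U: "unitary_L2 (\<lambda>u. scaleC_L2 c (T u))"
  \<comment> \<open>Recovering \<open>cmod c * k = 1\<close> from preservation of norms takes one
    nonzero vector. A Gaussian vanishes nowhere, and Lebesgue measure is not the zero
    measure.\<close>
  define u where "u = abs_L2 (gaussian 1 0 (0::'a))"
  have "u \<noteq> 0"
  proof
    assume "u = 0"
    then have "AE x in lborel. gaussian 1 0 (0::'a) x = 0"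
      unfolding u_def zero_L2_def by (simp add: abs_L2_eq_iff square_integrable_gaussian square_integrable_zero)
    then have "AE x in (lborel :: 'a measure). False"
      by (simp add: gaussian_def)
    then show False
      using ae_filter_eq_bot_iff[of "lborel :: 'a measure"] by (simp add: trivial_limit_def)
  qed
  have "norm (scaleC_L2 c (T u)) = norm u"
    using U by (simp add: unitary_L2_def norm_eq_sqrt_inner inner_L2_def)
  with \<open>u \<noteq> 0\<close> T show "cmod c * k = 1"
    by (simp add: scaled_unitary_def norm_scaleC_L2 mult.assoc[symmetric])
next
  assume ck: "cmod c * k = 1"
  then have c: "c \<noteq> 0" by auto
  have T': "bounded_operator_L2 T" "surj T"
    using T by (simp_all add: scaled_unitary_def)
  have "bounded_operator_L2 (\<lambda>u. scaleC_L2 c (T u))"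
    by (rule bounded_operator_compose[OF bounded_operator_scaleC T'(1)])
  moreover have "surj (\<lambda>u. scaleC_L2 c (T u))"
  proof (rule surjI)
    show "scaleC_L2 c (T (inv T (scaleC_L2 (1 / c) v))) = v" for v
      using c T' by (simp add: surj_f_inv_f)
  qed
  moreover have "cinner_L2 (scaleC_L2 c (T u)) (scaleC_L2 c (T v)) = cinner_L2 u v" for u v
  proof -
    have "cinner_L2 (scaleC_L2 c (T u)) (scaleC_L2 c (T v)) = (c * cnj c) * of_real (k\<^sup>2) * cinner_L2 u v"
      by (simp add: cinner_scaleC_left cinner_scaleC_right cinner_scaled_unitary[OF T])
    also have "(c * cnj c) * of_real (k\<^sup>2) = of_real ((cmod c * k)\<^sup>2)"
      unfolding complex_norm_square[symmetric] power_mult_distrib of_real_mult ..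
    finally show ?thesis
      by (simp add: ck)
  qed
  ultimately show "unitary_L2 (\<lambda>u. scaleC_L2 c (T u))"
    by (simp add: unitary_L2_def)
qed

context
  fixes s :: real
  assumes s: "s\<^sup>2 = 1"
begin

lemma fourier_L2_dist_le:
  fixes f g :: "'a::euclidean_space \<Rightarrow> complex"
  assumes "integrable lborel f" "square_integrable f" "integrable lborel g" "square_integrable g"
  shows "norm (abs_L2 (fourier s f) - abs_L2 (fourier s g))
    \<le> sqrt ((2 * pi) ^ DIM('a)) * norm (abs_L2 f - abs_L2 g)"
proof -
  have "norm (abs_L2 (fourier s (\<lambda>x. f x - g x))) \<le> sqrt ((2 * pi) ^ DIM('a)) * norm (abs_L2 (\<lambda>x. f x - g x))"
    using assms by (intro norm_fourier_L2_le square_integrable_diff s) auto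
  also have "fourier s (\<lambda>x. f x - g x) = (\<lambda>\<xi>. fourier s f \<xi> - fourier s g \<xi>)"
    using assms by (intro ext fourier_diff)
  finally show ?thesis
    using assms by (simp add: abs_L2_diff square_integrable_fourier s)
qed

text \<open>By the norm bound applied to differences, the transforms of the truncations form a
  Cauchy sequence, which converges by completeness. The same bound shows that any other
  approximating sequence has transforms asymptotic to these. The freedom in choosing
  \<open>g\<close> is what later proofs rely on.\<close>

lemma fourier_L2_tendsto:
  fixes u :: "'a::euclidean_space L2"
  assumes g: "\<And>n. integrable lborel (g n)" "\<And>n. square_integrable (g n)"
    and lim: "(\<lambda>n. abs_L2 (g n)) \<longlonglongrightarrow> u"
  shows "(\<lambda>n. abs_L2 (fourier s (g n))) \<longlonglongrightarrow> fourier_L2 s u"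
proof -
  define t where "t n = truncation n (rep_L2 u)" for n
  define C where "C = sqrt ((2 * pi) ^ DIM('a))"
  have t: "integrable lborel (t n)" "square_integrable (t n)" for n
    by (simp_all add: t_def integrable_truncation square_integrable_truncation square_integrable_rep)
  have t_lim: "(\<lambda>n. abs_L2 (t n)) \<longlonglongrightarrow> u"
    using truncation_tendsto[OF square_integrable_rep[of u]] by (simp add: t_def)
  have "Cauchy (\<lambda>n. abs_L2 (fourier s (t n)))"
  proof (rule metric_CauchyI)
    fix e :: real assume e: "e > 0"
    have C: "C > 0" by (simp add: C_def)
    have "Cauchy (\<lambda>n. abs_L2 (t n))"
      using t_lim by (rule LIMSEQ_imp_Cauchy)
    then obtain N where N: "\<And>m n. m \<ge> N \<Longrightarrow> n \<ge> N \<Longrightarrow> dist (abs_L2 (t m)) (abs_L2 (t n)) < e / C"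
      using e C by (metis metric_CauchyD divide_pos_pos)
    show "\<exists>M. \<forall>m\<ge>M. \<forall>n\<ge>M. dist (abs_L2 (fourier s (t m))) (abs_L2 (fourier s (t n))) < e"
    proof (intro exI[of _ N] allI impI)
      fix m n assume "N \<le> m" "N \<le> n"
      then have "C * norm (abs_L2 (t m) - abs_L2 (t n)) < e"
        using N[of m n] C by (simp add: dist_norm field_simps)
      then show "dist (abs_L2 (fourier s (t m))) (abs_L2 (fourier s (t n))) < e"
        using fourier_L2_dist_le[OF t t, of m n] by (simp add: C_def dist_norm)
    qed
  qed
  then have F: "(\<lambda>n. abs_L2 (fourier s (t n))) \<longlonglongrightarrow> fourier_L2 s u"
    by (simp add: fourier_L2_def t_def Cauchy_convergent_iff convergent_LIMSEQ_iff)
  have "(\<lambda>n. C * norm (abs_L2 (g n) - abs_L2 (t n))) \<longlonglongrightarrow> C * norm (u - u)"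
    by (intro tendsto_intros lim t_lim)
  then have "(\<lambda>n. C * norm (abs_L2 (g n) - abs_L2 (t n))) \<longlonglongrightarrow> 0"
    by simp
  then have "(\<lambda>n. abs_L2 (fourier s (g n)) - abs_L2 (fourier s (t n))) \<longlonglongrightarrow> 0"
    by (rule Lim_null_comparison[rotated])
       (unfold C_def, intro always_eventually allI fourier_L2_dist_le g t)
  from tendsto_add[OF this F] show ?thesis by simp
qed

lemma fourier_L2_abs:
  assumes "integrable lborel f" "square_integrable f"
  shows "fourier_L2 s (abs_L2 f) = abs_L2 (fourier s f)"
  using fourier_L2_tendsto[of "\<lambda>_. f"] assms LIMSEQ_unique tendsto_const by blast

lemma fourier_L2_trunc:
  "(\<lambda>n. abs_L2 (fourier s (truncation n (rep_L2 u)))) \<longlonglongrightarrow> fourier_L2 s u"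
  using truncation_tendsto[OF square_integrable_rep[of u]]
  by (intro fourier_L2_tendsto integrable_truncation square_integrable_truncation square_integrable_rep) simp

lemma norm_fourier_L2:
  "norm (fourier_L2 s u) \<le> sqrt ((2 * pi) ^ DIM('a)) * norm (u :: 'a::euclidean_space L2)"
proof (rule LIMSEQ_le)
  show "(\<lambda>n. norm (abs_L2 (fourier s (truncation n (rep_L2 u))))) \<longlonglongrightarrow> norm (fourier_L2 s u)"
    by (intro tendsto_norm fourier_L2_trunc)
  show "(\<lambda>n. sqrt ((2 * pi) ^ DIM('a)) * norm (abs_L2 (truncation n (rep_L2 u))))
      \<longlonglongrightarrow> sqrt ((2 * pi) ^ DIM('a)) * norm u"
    using truncation_tendsto[OF square_integrable_rep[of u]] by (intro tendsto_intros) simp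
qed (intro exI[of _ 0] allI impI norm_fourier_L2_le integrable_truncation square_integrable_truncation square_integrable_rep s)

text \<open>The representative of \<open>u + v\<close> is only almost everywhere the sum of the
  representatives. So \<open>u + v\<close> is approximated by sums of truncations rather than by
  truncations of its own representative, and similarly for scalar multiples.\<close>

lemma bounded_operator_fourier_L2: "bounded_operator_L2 (fourier_L2 s :: 'a::euclidean_space L2 \<Rightarrow> _)"
proof (rule bounded_operator_L2I[OF _ _ norm_fourier_L2])
  fix u v :: "'a L2" and c
  let ?t = "\<lambda>n u. truncation n (rep_L2 u)"
  note t = integrable_truncation square_integrable_truncation square_integrable_rep
  have t_lim: "(\<lambda>n. abs_L2 (?t n u)) \<longlonglongrightarrow> u" for u :: "'a L2"
    using truncation_tendsto[OF square_integrable_rep[of u]] by simp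
  have "(\<lambda>n. abs_L2 (fourier s (\<lambda>x. ?t n u x + ?t n v x))) \<longlonglongrightarrow> fourier_L2 s (u + v)"
    using tendsto_add[OF t_lim[of u] t_lim[of v]]
    by (intro fourier_L2_tendsto) (simp_all add: t square_integrable_add abs_L2_add)
  moreover have "abs_L2 (fourier s (\<lambda>x. ?t n u x + ?t n v x))
      = abs_L2 (fourier s (?t n u)) + abs_L2 (fourier s (?t n v))" for n
  proof -
    have "fourier s (\<lambda>x. ?t n u x + ?t n v x) = (\<lambda>\<xi>. fourier s (?t n u) \<xi> + fourier s (?t n v) \<xi>)"
      by (intro ext fourier_add t)
    then show ?thesis
      by (simp add: abs_L2_add square_integrable_fourier t s)
  qed
  ultimately show "fourier_L2 s (u + v) = fourier_L2 s u + fourier_L2 s v"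
    using tendsto_add[OF fourier_L2_trunc[of u] fourier_L2_trunc[of v]] LIMSEQ_unique by fastforce
  have "(\<lambda>n. scaleC_L2 c (abs_L2 (?t n u))) \<longlonglongrightarrow> scaleC_L2 c u"
    using bounded_operator_scaleC[of c] t_lim
    by (auto simp: bounded_operator_L2_def intro: bounded_linear.tendsto)
  then have "(\<lambda>n. abs_L2 (fourier s (\<lambda>x. c * ?t n u x))) \<longlonglongrightarrow> fourier_L2 s (scaleC_L2 c u)"
    by (intro fourier_L2_tendsto) (simp_all add: t square_integrable_cmult abs_L2_scaleC)
  moreover have "abs_L2 (fourier s (\<lambda>x. c * ?t n u x)) = scaleC_L2 c (abs_L2 (fourier s (?t n u)))" for n
    by (simp add: abs_L2_scaleC square_integrable_fourier t s fourier_cmult[abs_def])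
  moreover have "(\<lambda>n. scaleC_L2 c (abs_L2 (fourier s (?t n u)))) \<longlonglongrightarrow> scaleC_L2 c (fourier_L2 s u)"
    using bounded_operator_scaleC[of c] fourier_L2_trunc[of u]
    by (auto simp: bounded_operator_L2_def intro: bounded_linear.tendsto)
  ultimately show "fourier_L2 s (scaleC_L2 c u) = scaleC_L2 c (fourier_L2 s u)"
    using LIMSEQ_unique by fastforce
qed

lemma fourier_L2_gaussian:
  fixes a b :: "'a::euclidean_space"
  assumes "t > 0"
  shows "fourier_L2 s (abs_L2 (gaussian t a b))
    = scaleC_L2 (of_real (sqrt (2 * pi / t) ^ DIM('a)) * iexp (a \<bullet> b)) (abs_L2 (gaussian (1 / t) (- s *\<^sub>R b) (s *\<^sub>R a)))"
  using assms
  by (simp add: fourier_L2_abs integrable_gaussian square_integrable_gaussian abs_L2_scaleC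
      fourier_gaussian[OF assms s, abs_def])

end

text \<open>On \<open>gaussian t a 0\<close> the first transform produces width parameter
  \<open>1 / t\<close>, centre 0 and frequency \<open>s *\<^sub>R a\<close>; the second, with
  opposite sign, restores \<open>t\<close> and the centre \<open>s\<^sup>2\<close> times
  \<open>a\<close>. The scalar factors multiply to \<open>(2 * pi) ^ n\<close>, and agreement on
  these vectors determines a bounded operator.\<close>

lemma fourier_L2_inversion:
  fixes u :: "'a::euclidean_space L2"
  assumes s: "s\<^sup>2 = 1"
  shows "fourier_L2 (- s) (fourier_L2 s u) = scaleC_L2 (of_real ((2 * pi) ^ DIM('a))) u"
proof -
  have s': "(- s)\<^sup>2 = 1" using s by simp
  have "(\<lambda>u :: 'a L2. fourier_L2 (- s) (fourier_L2 s u)) = scaleC_L2 (of_real ((2 * pi) ^ DIM('a)))"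
  proof (rule bounded_operator_eqI)
    fix t :: real and a :: 'a assume t: "t > 0"
    have sc: "fourier_L2 (- s) (scaleC_L2 c v) = scaleC_L2 c (fourier_L2 (- s) v)" for c and v :: "'a L2"
      using bounded_operator_fourier_L2[OF s'] by (auto simp: bounded_operator_L2_def)
    have "complex_of_real (sqrt (2 * pi / t) ^ DIM('a)) * of_real (sqrt (2 * pi * t) ^ DIM('a))
        = of_real ((2 * pi) ^ DIM('a))"
      unfolding of_real_mult[symmetric] power_mult_distrib[symmetric] sqrt_two_pi_mult[OF t] ..
    then show "fourier_L2 (- s) (fourier_L2 s (abs_L2 (gaussian t a 0)))
        = scaleC_L2 (of_real ((2 * pi) ^ DIM('a))) (abs_L2 (gaussian t a 0))"
      using s t by (simp add: fourier_L2_gaussian[OF s] fourier_L2_gaussian[OF s'] sc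
          scaleR_scaleR power2_eq_square del: of_real_power)
  qed (rule bounded_operator_compose[OF bounded_operator_fourier_L2[OF s'] bounded_operator_fourier_L2[OF s]]
      bounded_operator_scaleC)+
  then show ?thesis by (simp add: fun_eq_iff)
qed

text \<open>The norm bound for both signs is sharp, so inversion forces equality.\<close>

lemma scaled_unitary_fourier_L2:
  assumes s: "s\<^sup>2 = 1"
  shows "scaled_unitary (sqrt ((2 * pi) ^ DIM('a))) (fourier_L2 s :: 'a::euclidean_space L2 \<Rightarrow> _)"
  unfolding scaled_unitary_def
proof (intro conjI allI)
  define C where "C = (2 * pi) ^ DIM('a)"
  have C: "C > 0" by (simp add: C_def)
  have s': "(- s)\<^sup>2 = 1" using s by simp
  show "bounded_operator_L2 (fourier_L2 s :: 'a L2 \<Rightarrow> _)"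
    by (rule bounded_operator_fourier_L2[OF s])
  show "surj (fourier_L2 s :: 'a L2 \<Rightarrow> _)"
  proof (rule surjI)
    fix v :: "'a L2"
    show "fourier_L2 s (scaleC_L2 (of_real (1 / C)) (fourier_L2 (- s) v)) = v"
      using bounded_operator_fourier_L2[OF s, where 'a='a] fourier_L2_inversion[OF s', of v, folded C_def] C
      by (auto simp: bounded_operator_L2_def)
  qed
  fix u :: "'a L2"
  have "C * norm u = norm (fourier_L2 (- s) (fourier_L2 s u))"
    unfolding fourier_L2_inversion[OF s, of u, folded C_def] norm_scaleC_L2 norm_of_real using C by simp
  also have "\<dots> \<le> sqrt C * norm (fourier_L2 s u)"
    unfolding C_def by (rule norm_fourier_L2[OF s'])
  finally have "sqrt C * (sqrt C * norm u) \<le> sqrt C * norm (fourier_L2 s u)"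
    using C by (simp flip: mult.assoc)
  then have "sqrt C * norm u \<le> norm (fourier_L2 s u)"
    using C by simp
  with norm_fourier_L2[OF s, of u] show "norm (fourier_L2 s u) = sqrt ((2 * pi) ^ DIM('a)) * norm u"
    by (simp add: C_def)
qed

subsection \<open>Linear substitutions\<close>

text \<open>Lebesgue measure is characterised among Borel measures by its values on boxes, so only
  preimages of boxes need to be measured.\<close>

lemma lborel_eq_distr_of_box:
  fixes f :: "'a::euclidean_space \<Rightarrow> 'a"
  assumes f: "f \<in> borel_measurable borel" and "\<And>l u. emeasure lborel (f -` box l u) = emeasure lborel (box l u)"
  shows "distr lborel borel f = lborel"
proof (rule lborel_eqI[symmetric])
  fix l u :: 'a assume le: "\<And>b. b \<in> Basis \<Longrightarrow> l \<bullet> b \<le> u \<bullet> b"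
  have "emeasure (distr lborel borel f) (box l u) = emeasure lborel (box l u)"
    using assms by (subst emeasure_distr) auto
  then show "emeasure (distr lborel borel f) (box l u) = (\<Prod>b\<in>Basis. (u - l) \<bullet> b)"
    using le by (simp add: inner_diff_left)
qed simp

lemma linear_imp_borel_measurable:
  fixes f :: "'a::euclidean_space \<Rightarrow> 'b::real_normed_vector"
  shows "linear f \<Longrightarrow> f \<in> borel_measurable borel"
  by (intro borel_measurable_continuous_onI linear_continuous_on) (simp add: linear_conv_bounded_linear)

lemma Basis_cart_eq: "(Basis :: (real^'n) set) = range (\<lambda>i. axis i 1)"
  by (auto simp: Basis_vec_def)

lemma det_shear:
  fixes m n :: "'n::finite"
  assumes "m \<noteq> n"
  shows "det (matrix (\<lambda>x::real^'n. \<chi> i. if i = m then x $ m + x $ n else x $ i)) = 1"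
proof -
  have "matrix (\<lambda>x::real^'n. \<chi> i. if i = m then x $ m + x $ n else x $ i)
      = (\<chi> k. if k = m then row m (mat 1) + 1 *s row n (mat 1) else row k (mat 1 :: real^'n^'n))"
    by (auto simp: matrix_def vec_eq_iff row_def mat_def axis_def)
  then show ?thesis
    by (simp only: det_row_operation[OF assms] det_I)
qed

lemma emeasure_shear_box:
  fixes m n :: "'n::finite" and l u :: "real^'n"
  assumes mn: "m \<noteq> n"
  defines "h \<equiv> (\<lambda>x::real^'n. \<chi> i. if i = m then x $ m + x $ n else x $ i)"
  shows "emeasure lborel (h ` box l u) = emeasure lborel (box l u)"
proof -
  have lin: "linear h"
    unfolding h_def by (rule linearI) (auto simp: algebra_simps vec_eq_iff)
  have cbox: "measure lebesgue (h ` cbox a b) = 1 * measure lebesgue (cbox a b)" for a b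
  proof (cases "cbox a b = {}")
    case False
    \<comment> \<open>\<open>measure_shear_interval\<close> asks for a nonnegative
      \<open>n\<close>-th coordinate of the lower corner, so the box is translated to have its lower
      corner at 0.\<close>
    have eq: "cbox a b = (+) a ` cbox 0 (b - a)"
      using cbox_translation[of a 0 "b - a"] by simp
    have "h ` cbox a b = (+) (h a) ` (h ` cbox 0 (b - a))"
      unfolding eq image_image by (simp add: linear_add[OF lin])
    moreover have "measure lebesgue (h ` cbox 0 (b - a)) = measure lebesgue (cbox 0 (b - a))"
      using measure_shear_interval[OF mn, of 0 "b - a"] False eq by (auto simp: h_def)
    ultimately show ?thesis
      unfolding eq by (simp add: measure_translation)
  qed simp
  have "h ` box l u \<in> lmeasurable \<and> 1 * measure lebesgue (box l u) = measure lebesgue (h ` box l u)"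
    by (rule measure_linear_sufficient[OF lin _ cbox]) simp
  then have "emeasure lebesgue (h ` box l u) = emeasure lebesgue (box l u)"
    by (simp add: emeasure_eq_measure2 fmeasurableD lmeasurable_box)
  \<comment> \<open>The equality just obtained concerns the completed measure; it descends to
    \<open>lborel\<close> because the image is open, being the preimage of the box under the inverse
    shear \<open>k\<close>.\<close>
  moreover have "h ` box l u \<in> sets borel"
  proof -
    define k where "k x = (\<chi> i. if i = m then x $ m - x $ n else x $ i)" for x :: "real^'n"
    have "h ` box l u = k -` box l u"
    proof (intro set_eqI iffI)
      fix x assume "x \<in> k -` box l u"
      moreover have "h (k x) = x" using mn by (simp add: h_def k_def vec_eq_iff)
      ultimately show "x \<in> h ` box l u" by (metis imageI vimageE)
    next
      fix x assume "x \<in> h ` box l u"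
      moreover have "k (h y) = y" for y using mn by (simp add: h_def k_def vec_eq_iff)
      ultimately show "x \<in> k -` box l u" by auto
    qed
    moreover have "linear k"
      unfolding k_def by (rule linearI) (auto simp: algebra_simps vec_eq_iff)
    then have "open (k -` box l u)"
      by (intro open_vimage open_box linear_continuous_on linear_conv_bounded_linear[THEN iffD1])
    ultimately show ?thesis by simp
  qed
  ultimately show ?thesis by simp
qed

text \<open>The linear change of variables in the library is restricted to well-ordered index types.\<close>

lemma nn_integral_lborel_linear:
  fixes f :: "real^'n \<Rightarrow> real^'n"
  assumes "linear f"
  shows "det (matrix f) \<noteq> 0 \<longrightarrow> (\<forall>v\<in>borel_measurable borel.
    (\<integral>\<^sup>+x. v x \<partial>lborel) = ennreal \<bar>det (matrix f)\<bar> * (\<integral>\<^sup>+x. v (f x) \<partial>lborel))"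
\<comment> \<open>Elementary maps generate all linear maps, and the determinant is multiplicative.
  The nonvanishing of the determinant is an implication inside the induction predicate because the
  induction also passes through singular maps, those with a zero row.\<close>
proof (rule induct_linear_elementary[OF assms])
  fix f g :: "real^'n \<Rightarrow> real^'n"
  assume lin: "linear f" "linear g"
    and IH: "det (matrix f) \<noteq> 0 \<longrightarrow> (\<forall>v\<in>borel_measurable borel.
      (\<integral>\<^sup>+x. v x \<partial>lborel) = ennreal \<bar>det (matrix f)\<bar> * (\<integral>\<^sup>+x. v (f x) \<partial>lborel))"
    "det (matrix g) \<noteq> 0 \<longrightarrow> (\<forall>v\<in>borel_measurable borel.
      (\<integral>\<^sup>+x. v x \<partial>lborel) = ennreal \<bar>det (matrix g)\<bar> * (\<integral>\<^sup>+x. v (g x) \<partial>lborel))"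
  have det: "det (matrix (f \<circ> g)) = det (matrix f) * det (matrix g)"
    by (simp add: matrix_compose lin det_mul)
  show "det (matrix (f \<circ> g)) \<noteq> 0 \<longrightarrow> (\<forall>v\<in>borel_measurable borel.
      (\<integral>\<^sup>+x. v x \<partial>lborel) = ennreal \<bar>det (matrix (f \<circ> g))\<bar> * (\<integral>\<^sup>+x. v ((f \<circ> g) x) \<partial>lborel))"
  proof (intro impI ballI)
    fix v :: "real^'n \<Rightarrow> ennreal" assume nz: "det (matrix (f \<circ> g)) \<noteq> 0" and v: "v \<in> borel_measurable borel"
    have "f \<in> borel_measurable borel"
      by (rule linear_imp_borel_measurable[OF lin(1)])
    with v have "(\<lambda>x. v (f x)) \<in> borel_measurable borel"
      by measurable
    then have "(\<integral>\<^sup>+x. v (f x) \<partial>lborel) = ennreal \<bar>det (matrix g)\<bar> * (\<integral>\<^sup>+x. v (f (g x)) \<partial>lborel)"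
      using IH(2) nz unfolding det by (auto dest: bspec)
    moreover have "(\<integral>\<^sup>+x. v x \<partial>lborel) = ennreal \<bar>det (matrix f)\<bar> * (\<integral>\<^sup>+x. v (f x) \<partial>lborel)"
      using IH(1) nz v unfolding det by (auto dest: bspec)
    ultimately show "(\<integral>\<^sup>+x. v x \<partial>lborel) = ennreal \<bar>det (matrix (f \<circ> g))\<bar> * (\<integral>\<^sup>+x. v ((f \<circ> g) x) \<partial>lborel)"
      by (simp add: det abs_mult ennreal_mult mult.assoc)
  qed
next
  fix f :: "real^'n \<Rightarrow> real^'n" and i
  assume "linear f" and 0: "\<And>x. f x $ i = 0"
  have "det (matrix f) = 0"
    by (rule det_zero_row(2)[of i]) (simp add: row_def matrix_def 0 vec_eq_iff)
  then show "det (matrix f) \<noteq> 0 \<longrightarrow> (\<forall>v\<in>borel_measurable borel.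
    (\<integral>\<^sup>+x. v x \<partial>lborel) = ennreal \<bar>det (matrix f)\<bar> * (\<integral>\<^sup>+x. v (f x) \<partial>lborel))"
    by simp
next
  fix c :: "'n \<Rightarrow> real"
  let ?f = "\<lambda>x::real^'n. \<chi> i. c i * x $ i"
  have det: "det (matrix ?f) = prod c UNIV"
    by (simp add: axis_def matrix_def det_diagonal)
  show "det (matrix ?f) \<noteq> 0 \<longrightarrow> (\<forall>v\<in>borel_measurable borel.
    (\<integral>\<^sup>+x. v x \<partial>lborel) = ennreal \<bar>det (matrix ?f)\<bar> * (\<integral>\<^sup>+x. v (?f x) \<partial>lborel))"
  proof (intro impI ballI)
    fix v :: "real^'n \<Rightarrow> ennreal"
    assume nz: "det (matrix ?f) \<noteq> 0" and [measurable]: "v \<in> borel_measurable borel"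
    \<comment> \<open>\<open>lborel_affine_euclidean\<close> scales along the vectors of
      \<open>Basis\<close>, so the factors are re-indexed from coordinates to basis vectors.\<close>
    define d where "d b = c (axis_index b)" for b :: "real^'n"
    have d: "d (axis i 1) = c i" for i
      by (simp add: d_def axis_index_axis)
    have T: "(\<Sum>j\<in>Basis. (d j * (x \<bullet> j)) *\<^sub>R j) = ?f x" for x
      by (subst euclidean_representation[of "?f x", symmetric], rule sum.cong)
         (auto simp: Basis_vec_def d inner_axis)
    have prod: "(\<Prod>j\<in>Basis. \<bar>d j\<bar>) = \<bar>prod c UNIV\<bar>"
      by (simp add: Basis_cart_eq prod.reindex inj_on_def axis_eq_axis d abs_prod)
    have "lborel = density (distr lborel borel (\<lambda>x. 0 + (\<Sum>j\<in>Basis. (d j * (x \<bullet> j)) *\<^sub>R j)))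
        (\<lambda>_. (\<Prod>j\<in>Basis. \<bar>d j\<bar>))"
      using nz by (intro lborel_affine_euclidean) (auto simp: det Basis_vec_def d)
    then have l: "lborel = density (distr lborel borel ?f) (\<lambda>_. ennreal \<bar>det (matrix ?f)\<bar>)"
      by (simp add: T prod det)
    have [measurable]: "?f \<in> borel_measurable borel"
      by (intro borel_measurable_continuous_onI continuous_intros)
    show "(\<integral>\<^sup>+x. v x \<partial>lborel) = ennreal \<bar>det (matrix ?f)\<bar> * (\<integral>\<^sup>+x. v (?f x) \<partial>lborel)"
      by (subst l) (simp add: nn_integral_density nn_integral_distr nn_integral_cmult)
  qed
next
  fix m n :: 'n assume mn: "m \<noteq> n"
  let ?f = "\<lambda>x::real^'n. \<chi> i. x $ Transposition.transpose m n i"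
  let ?p = "Transposition.transpose m n"
  have lin: "linear ?f"
    by (rule linearI) (simp_all add: vec_eq_iff)
  have inv: "?f (?f x) = x" for x
    by (simp add: vec_eq_iff)
  have "matrix ?f ** matrix ?f = mat 1"
    using matrix_compose[OF lin lin] inv by (simp add: comp_def matrix_id_mat_1 flip: id_def)
  then have "det (matrix ?f) * det (matrix ?f) = 1"
    by (metis det_I det_mul)
  then have det: "\<bar>det (matrix ?f)\<bar> = 1"
    by (metis abs_mult_self_eq abs_of_nonneg abs_one abs_square_eq_1 power2_eq_square)
  have [measurable]: "?f \<in> borel_measurable borel"
    by (intro borel_measurable_continuous_onI continuous_intros)
  have "distr lborel borel ?f = lborel"
  proof (rule lborel_eq_distr_of_box)
    fix l u :: "real^'n"
    have mem: "?f x \<in> box l u \<longleftrightarrow> x \<in> box (?f l) (?f u)" for x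
      unfolding mem_box_cart by simp (metis transpose_involutory)
    then have "?f -` box l u = box (?f l) (?f u)" by auto
    moreover have "(\<forall>i. l $ i \<le> u $ i) \<longleftrightarrow> (\<forall>i. l $ ?p i \<le> u $ ?p i)"
      by (metis transpose_involutory)
    moreover have "(\<Prod>i\<in>UNIV. u $ ?p i - l $ ?p i) = (\<Prod>i\<in>UNIV. u $ i - l $ i)"
      using prod.permute[OF permutes_swap_id[of m UNIV n], of "\<lambda>i. u $ i - l $ i"] by (simp add: comp_def)
    ultimately show "emeasure lborel (?f -` box l u) = emeasure lborel (box l u)"
      by (simp add: emeasure_lborel_box_eq Basis_cart_eq inner_axis prod.reindex inj_on_def axis_eq_axis)
  qed measurable
  then have "(\<integral>\<^sup>+x. v x \<partial>lborel) = (\<integral>\<^sup>+x. v (?f x) \<partial>lborel)" if [measurable]: "v \<in> borel_measurable borel" for v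
    using nn_integral_distr[of ?f lborel borel v] by simp
  note f_eq = this
  show "det (matrix ?f) \<noteq> 0 \<longrightarrow> (\<forall>v\<in>borel_measurable borel.
    (\<integral>\<^sup>+x. v x \<partial>lborel) = ennreal \<bar>det (matrix ?f)\<bar> * (\<integral>\<^sup>+x. v (?f x) \<partial>lborel))"
    unfolding det by (intro impI ballI, simp only: ennreal_1 mult_1) (rule f_eq)
next
  fix m n :: 'n assume mn: "m \<noteq> n"
  let ?h = "\<lambda>x::real^'n. \<chi> i. if i = m then x $ m + x $ n else x $ i"
  define k where "k x = (\<chi> i. if i = m then x $ m - x $ n else x $ i)" for x :: "real^'n"
  have kh: "k (?h x) = x" and hk: "?h (k x) = x" for x
    using mn by (simp_all add: k_def vec_eq_iff)
  have lin: "linear ?h" "linear k"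
    unfolding k_def by (rule linearI; auto simp: algebra_simps vec_eq_iff)+
  have [measurable]: "?h \<in> borel_measurable borel" "k \<in> borel_measurable borel"
    by (intro linear_imp_borel_measurable lin)+
  have "distr lborel borel k = lborel"
  proof (rule lborel_eq_distr_of_box)
    fix l u :: "real^'n"
    have "k -` box l u = ?h ` box l u"
      using kh hk by (auto simp: image_iff) metis
    then show "emeasure lborel (k -` box l u) = emeasure lborel (box l u)"
      using emeasure_shear_box[OF mn] by simp
  qed measurable
  then have k: "(\<integral>\<^sup>+x. v x \<partial>lborel) = (\<integral>\<^sup>+x. v (k x) \<partial>lborel)" if "v \<in> borel_measurable borel" for v
    using nn_integral_distr[of k lborel borel v] that by simp
  have "(\<integral>\<^sup>+x. v x \<partial>lborel) = (\<integral>\<^sup>+x. v (?h x) \<partial>lborel)" if [measurable]: "v \<in> borel_measurable borel" for v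
  proof -
    have "(\<lambda>x. v (?h x)) \<in> borel_measurable borel"
      by (rule measurable_compose[OF linear_imp_borel_measurable[OF lin(1)] that])
    from k[OF this] show ?thesis
      unfolding hk by (rule sym)
  qed
  note h_eq = this
  show "det (matrix ?h) \<noteq> 0 \<longrightarrow> (\<forall>v\<in>borel_measurable borel.
    (\<integral>\<^sup>+x. v x \<partial>lborel) = ennreal \<bar>det (matrix ?h)\<bar> * (\<integral>\<^sup>+x. v (?h x) \<partial>lborel))"
    unfolding det_shear[OF mn] by (intro impI ballI, simp only: abs_one ennreal_1 mult_1) (rule h_eq)
qed

subsection \<open>Unimodular multiplications and matrix substitutions on L2\<close>

definition mult_L2 :: "('a::euclidean_space \<Rightarrow> complex) \<Rightarrow> 'a L2 \<Rightarrow> 'a L2" where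
  "mult_L2 p u = abs_L2 (\<lambda>x. p x * rep_L2 u x)"

context
  fixes p :: "'a::euclidean_space \<Rightarrow> complex"
  assumes p: "p \<in> borel_measurable borel" and unimodular: "\<And>x. norm (p x) = 1"
begin

lemma square_integrable_unimodular_mult:
  assumes "square_integrable f"
  shows "square_integrable (\<lambda>x. p x * f x)"
proof (rule square_integrable_norm_le[OF assms])
  show "(\<lambda>x. p x * f x) \<in> borel_measurable borel"
    using p assms by (auto simp: square_integrable_def)
qed (simp add: norm_mult unimodular)

lemma mult_L2_abs:
  assumes "square_integrable f"
  shows "mult_L2 p (abs_L2 f) = abs_L2 (\<lambda>x. p x * f x)"
  using rep_abs_L2_AE[OF assms] unfolding mult_L2_def
  by (subst abs_L2_eq_iff) (auto simp: square_integrable_unimodular_mult square_integrable_rep assms elim: AE_mp)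

lemma norm_mult_L2: "norm (mult_L2 p u) = norm u"
proof (cases u rule: L2_cases)
  case (abs f)
  have "(norm (mult_L2 p u))\<^sup>2 = (norm u)\<^sup>2"
    by (simp add: abs mult_L2_abs norm_abs_L2_sq square_integrable_unimodular_mult norm_mult unimodular)
  then show ?thesis by simp
qed

lemma bounded_operator_mult_L2: "bounded_operator_L2 (mult_L2 p)"
proof (rule bounded_operator_L2I[of _ 1])
  fix u v :: "'a L2" and c
  obtain f where f: "square_integrable f" "u = abs_L2 f" by (rule L2_cases)
  obtain g where g: "square_integrable g" "v = abs_L2 g" by (rule L2_cases)
  show "mult_L2 p (u + v) = mult_L2 p u + mult_L2 p v"
    by (simp add: f g abs_L2_add mult_L2_abs square_integrable_add square_integrable_unimodular_mult distrib_left)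
  show "mult_L2 p (scaleC_L2 c u) = scaleC_L2 c (mult_L2 p u)"
    by (simp add: f abs_L2_scaleC mult_L2_abs square_integrable_cmult square_integrable_unimodular_mult mult.left_commute)
qed (simp add: norm_mult_L2)

end

lemma scaled_unitary_mult_L2:
  assumes p: "p \<in> borel_measurable borel" and u: "\<And>x. norm (p x) = 1"
  shows "scaled_unitary 1 (mult_L2 p :: 'a::euclidean_space L2 \<Rightarrow> _)"
  unfolding scaled_unitary_def
proof (intro conjI allI)
  have "cnj \<in> borel_measurable borel"
    by (intro borel_measurable_continuous_onI continuous_intros)
  then have c: "(\<lambda>x. cnj (p x)) \<in> borel_measurable borel" "norm (cnj (p x)) = 1" for x
    using p u by (simp_all add: measurable_compose[OF p])
  have pc: "p x * cnj (p x) = 1" for x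
    using complex_norm_square[of "p x"] u[of x] by simp
  then have "mult_L2 p (mult_L2 (\<lambda>x. cnj (p x)) v) = v" for v :: "'a L2"
    using p u c by (cases v rule: L2_cases) (simp add: mult_L2_abs square_integrable_unimodular_mult pc flip: mult.assoc)
  then show "surj (mult_L2 p :: 'a L2 \<Rightarrow> _)"
    by (rule surjI)
qed (simp_all add: bounded_operator_mult_L2[OF p u] norm_mult_L2[OF p u])

definition subst_L2 :: "real^'n^'n \<Rightarrow> (real^'n) L2 \<Rightarrow> (real^'n) L2" where
  "subst_L2 R u = abs_L2 (\<lambda>x. rep_L2 u (R *v x))"

lemma matrix_vector_measurable: "(\<lambda>x. R *v x) \<in> borel_measurable (borel :: (real^'n) measure)"
  by (rule linear_imp_borel_measurable) simp

context
  fixes R :: "real^'n^'n"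
  assumes R: "det R \<noteq> 0"
begin

lemma nn_integral_matrix_subst:
  "v \<in> borel_measurable borel \<Longrightarrow>
    (\<integral>\<^sup>+x. v x \<partial>lborel) = ennreal \<bar>det R\<bar> * (\<integral>\<^sup>+x. v (R *v x) \<partial>lborel)"
  using nn_integral_lborel_linear[of "(*v) R"] R by (auto dest: bspec)

text \<open>By the change of variables a null set has a null preimage. This makes
  \<open>subst_L2\<close> independent of the representative.\<close>

lemma AE_matrix_subst:
  assumes "AE x in lborel. P x"
  shows "AE x in lborel. P (R *v x)"
proof -
  obtain N where N: "{x. \<not> P x} \<subseteq> N" "N \<in> sets borel" "emeasure lborel N = 0"
    using assms by (auto elim!: AE_E)
  have [measurable]: "(\<lambda>x. R *v x) \<in> borel_measurable borel" "N \<in> sets borel"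
    by (rule matrix_vector_measurable) fact
  have "ennreal \<bar>det R\<bar> * (\<integral>\<^sup>+x. indicator N (R *v x) \<partial>lborel) = emeasure lborel N"
    using nn_integral_matrix_subst[of "indicator N"] N by simp
  then have "(\<integral>\<^sup>+x. indicator N (R *v x) \<partial>(lborel :: (real^'n) measure)) = 0"
    using R N(3) by simp
  then have "AE x in lborel. indicator N (R *v x) = (0 :: ennreal)"
    by (subst (asm) nn_integral_0_iff_AE) simp_all
  then show ?thesis
    by (rule AE_mp) (use N(1) in \<open>auto simp: indicator_def split: if_splits intro!: AE_I2\<close>)
qed

lemma nn_integral_norm_subst:
  fixes f :: "real^'n \<Rightarrow> complex"
  assumes f: "square_integrable f"
  shows "ennreal \<bar>det R\<bar> * (\<integral>\<^sup>+x. ennreal ((norm (f (R *v x)))\<^sup>2) \<partial>lborel) = ennreal ((norm (abs_L2 f))\<^sup>2)"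
proof -
  have [measurable]: "f \<in> borel_measurable borel"
    using f by (simp add: square_integrable_def)
  show ?thesis
    unfolding nn_integral_norm_abs_L2[OF f, symmetric] by (rule nn_integral_matrix_subst[symmetric]) measurable
qed

lemma square_integrable_subst:
  fixes f :: "real^'n \<Rightarrow> complex"
  assumes f: "square_integrable f"
  shows "square_integrable (\<lambda>x. f (R *v x))"
proof (rule square_integrableI_nn)
  show "(\<lambda>x. f (R *v x)) \<in> borel_measurable borel"
    using f by (intro measurable_compose[OF matrix_vector_measurable]) (simp add: square_integrable_def)
  show "(\<integral>\<^sup>+x. ennreal ((norm (f (R *v x)))\<^sup>2) \<partial>lborel) < \<infinity>"
    using nn_integral_norm_subst[OF f] R
    by (metis ennreal_less_top ennreal_mult_eq_top_iff ennreal_eq_0_iff abs_le_zero_iff infinity_ennreal_def less_top)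
qed

lemma subst_L2_abs:
  assumes "square_integrable f"
  shows "subst_L2 R (abs_L2 f) = abs_L2 (\<lambda>x. f (R *v x))"
  using AE_matrix_subst[OF rep_abs_L2_AE[OF assms]] unfolding subst_L2_def
  by (subst abs_L2_eq_iff) (auto simp: square_integrable_subst square_integrable_rep assms)

lemma norm_subst_L2: "norm (subst_L2 R u) = 1 / sqrt \<bar>det R\<bar> * norm u"
proof (cases u rule: L2_cases)
  case (abs f)
  have "ennreal (\<bar>det R\<bar> * (norm (subst_L2 R u))\<^sup>2) = ennreal ((norm u)\<^sup>2)"
    using nn_integral_norm_subst[OF abs(1)]
    by (simp add: nn_integral_norm_abs_L2 square_integrable_subst abs subst_L2_abs ennreal_mult)
  then have "\<bar>det R\<bar> * (norm (subst_L2 R u))\<^sup>2 = (norm u)\<^sup>2"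
    by simp
  then have "sqrt \<bar>det R\<bar> * norm (subst_L2 R u) = norm u"
    by (metis norm_ge_zero real_sqrt_abs real_sqrt_mult abs_of_nonneg)
  then show ?thesis
    using R by (simp add: field_simps)
qed

lemma bounded_operator_subst_L2: "bounded_operator_L2 (subst_L2 R)"
proof (rule bounded_operator_L2I[of _ "1 / sqrt \<bar>det R\<bar>"])
  fix u v :: "(real^'n) L2" and c
  obtain f where f: "square_integrable f" "u = abs_L2 f" by (rule L2_cases)
  obtain g where g: "square_integrable g" "v = abs_L2 g" by (rule L2_cases)
  show "subst_L2 R (u + v) = subst_L2 R u + subst_L2 R v"
    by (simp add: f g abs_L2_add subst_L2_abs square_integrable_add square_integrable_subst)
  show "subst_L2 R (scaleC_L2 c u) = scaleC_L2 c (subst_L2 R u)"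
    by (simp add: f abs_L2_scaleC subst_L2_abs square_integrable_cmult square_integrable_subst)
qed (simp add: norm_subst_L2)

end

lemma scaled_unitary_subst_L2:
  fixes R :: "real^'n^'n"
  assumes R: "det R \<noteq> 0"
  shows "scaled_unitary (1 / sqrt \<bar>det R\<bar>) (subst_L2 R)"
  unfolding scaled_unitary_def
proof (intro conjI allI)
  obtain R' where R': "R ** R' = mat 1" "R' ** R = mat 1"
    using R by (auto simp: invertible_def simp flip: invertible_det_nz)
  then have "det R' \<noteq> 0"
    by (metis det_I det_mul mult_zero_right zero_neq_one)
  then have "subst_L2 R (subst_L2 R' v) = v" for v
    using R R'(2) by (cases v rule: L2_cases)
      (simp add: subst_L2_abs square_integrable_subst matrix_vector_mul_assoc)
  then show "surj (subst_L2 R)"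
    by (rule surjI)
qed (simp_all add: bounded_operator_subst_L2[OF R] norm_subst_L2[OF R])

subsection \<open>Schwartz functions\<close>

lemma schwartz_measurable:
  assumes "\<phi> \<in> schwartz"
  shows "\<phi> \<in> borel_measurable borel"
proof (intro borel_measurable_continuous_onI continuous_at_imp_continuous_on ballI)
  fix x
  have "iter_partial [] \<phi> differentiable (at x)"
    using assms unfolding schwartz_def by blast
  then show "isCont \<phi> x"
    by (simp add: differentiable_imp_continuous_within)
qed

text \<open>Expanding the product of the factors \<open>1 + (x $ j)\<^sup>2\<close> gives a sum over
  subsets \<open>X\<close> of the coordinates of monomials with exponents 0 and 2, each of which is
  bounded against \<open>\<phi>\<close>. The resulting majorant factors into integrable functions of
  one variable.\<close>

lemma schwartz_decay:
  fixes \<phi> :: "real^'n \<Rightarrow> complex"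
  assumes "\<phi> \<in> schwartz"
  obtains K where "\<And>x. norm (\<phi> x) \<le> K * (\<Prod>j\<in>UNIV. inverse (1 + (x $ j)\<^sup>2))"
proof -
  have "\<exists>K. \<forall>x. (\<Prod>j\<in>X. (x $ j)\<^sup>2) * norm (\<phi> x) \<le> K" for X :: "'n set"
  proof -
    define \<alpha> :: "'n \<Rightarrow> nat" where "\<alpha> j = (if j \<in> X then 2 else 0)" for j
    have "bounded (range (\<lambda>x. (\<Prod>j\<in>UNIV. (x $ j) ^ \<alpha> j) *\<^sub>R iter_partial [] \<phi> x))"
      using assms unfolding schwartz_def by blast
    then obtain K where K: "\<And>x. norm ((\<Prod>j\<in>UNIV. (x $ j) ^ \<alpha> j) *\<^sub>R \<phi> x) \<le> K"
      by (auto simp: bounded_iff)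
    have eq: "(\<Prod>j\<in>UNIV. (x $ j) ^ \<alpha> j) = (\<Prod>j\<in>X. (x $ j)\<^sup>2)" for x :: "real^'n"
      by (rule prod.mono_neutral_cong_right) (auto simp: \<alpha>_def)
    show ?thesis
      using K unfolding eq by (intro exI[of _ K]) (simp add: abs_prod)
  qed
  then obtain K where K: "\<And>X x. (\<Prod>j\<in>X. (x $ j)\<^sup>2) * norm (\<phi> x) \<le> K X"
    by metis
  show ?thesis
  proof (rule that)
    fix x :: "real^'n"
    define P where "P = (\<Prod>j\<in>UNIV. (x $ j)\<^sup>2 + 1)"
    have pos: "P > 0"
      unfolding P_def by (intro prod_pos) (auto intro: add_nonneg_pos)
    have inv: "(\<Prod>j\<in>UNIV. inverse (1 + (x $ j)\<^sup>2)) = inverse P"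
      unfolding P_def prod_inversef[symmetric] by (simp add: comp_def add.commute)
    have "P * norm (\<phi> x) = (\<Sum>X\<in>UNIV. (\<Prod>j\<in>X. (x $ j)\<^sup>2) * norm (\<phi> x))"
      by (simp add: P_def prod_add sum_distrib_right)
    also have "\<dots> \<le> (\<Sum>X\<in>UNIV. K X)"
      by (intro sum_mono K)
    finally show "norm (\<phi> x) \<le> (\<Sum>X\<in>UNIV. K X) * (\<Prod>j\<in>UNIV. inverse (1 + (x $ j)\<^sup>2))"
      using pos unfolding inv by (simp add: field_simps)
  qed
qed

lemma integrable_prod_inverse_square:
  "integrable lborel (\<lambda>x::real^'n. \<Prod>j\<in>UNIV. inverse (1 + (x $ j)\<^sup>2))"
proof -
  have "integrable lborel (\<lambda>x::real. inverse (1 + x\<^sup>2))"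
    using integrable_inverse_1_plus_square by (simp add: set_integrable_def einterval_def)
  from integrable_lborel_prod[where f="\<lambda>b::real^'n. \<lambda>x. inverse (1 + x\<^sup>2)", OF this]
  show ?thesis
    by (simp add: Basis_cart_eq prod.reindex inj_on_def axis_eq_axis inner_axis)
qed

lemma integrable_schwartz:
  fixes \<phi> :: "real^'n \<Rightarrow> complex"
  assumes "\<phi> \<in> schwartz"
  shows "integrable lborel \<phi>" and "square_integrable \<phi>"
proof -
  have [measurable]: "\<phi> \<in> borel_measurable borel"
    by (rule schwartz_measurable[OF assms])
  obtain K where K: "\<And>x. norm (\<phi> x) \<le> K * (\<Prod>j\<in>UNIV. inverse (1 + (x $ j)\<^sup>2))"
    using schwartz_decay[OF assms] by blast
  have P: "0 \<le> (\<Prod>j\<in>UNIV. inverse (1 + (x $ j)\<^sup>2))" "(\<Prod>j\<in>UNIV. inverse (1 + (x $ j)\<^sup>2)) \<le> 1" for x :: "real^'n"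
    by (intro prod_nonneg prod_le_1; auto simp: inverse_le_1_iff intro: add_nonneg_nonneg)+
  have "0 \<le> K * (\<Prod>j\<in>UNIV. inverse (1 + ((0::real^'n) $ j)\<^sup>2))"
    using K[of 0] norm_ge_zero order_trans by blast
  then have K0: "0 \<le> K" by simp
  show \<phi>: "integrable lborel \<phi>"
  proof (rule Bochner_Integration.integrable_bound)
    show "integrable lborel (\<lambda>x::real^'n. K * (\<Prod>j\<in>UNIV. inverse (1 + (x $ j)\<^sup>2)))"
      by (intro integrable_mult_right integrable_prod_inverse_square)
  qed (use K order_trans[OF K abs_ge_self] in auto)
  have bound: "norm (\<phi> x) \<le> K" for x
    using K[of x] mult_left_mono[OF P(2) K0, of x] by simp
  have "integrable lborel (\<lambda>x. (norm (\<phi> x))\<^sup>2)"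
  proof (rule Bochner_Integration.integrable_bound)
    show "integrable lborel (\<lambda>x. K * norm (\<phi> x))"
      using \<phi> by simp
    show "AE x in lborel. norm ((norm (\<phi> x))\<^sup>2) \<le> norm (K * norm (\<phi> x))"
      using K0 by (auto simp: power2_eq_square abs_mult intro!: mult_right_mono bound)
  qed measurable
  then show "square_integrable \<phi>"
    by (simp add: square_integrable_def)
qed

section \<open>Gaussians are Schwartz functions\<close>

inductive_set gaussian_polys :: "real \<Rightarrow> real^'n \<Rightarrow> (real^'n \<Rightarrow> complex) set" for t a where
  gaussian: "gaussian t a 0 \<in> gaussian_polys t a"
| add: "f \<in> gaussian_polys t a \<Longrightarrow> g \<in> gaussian_polys t a \<Longrightarrow> (\<lambda>x. f x + g x) \<in> gaussian_polys t a"
| cmult: "f \<in> gaussian_polys t a \<Longrightarrow> (\<lambda>x. c * f x) \<in> gaussian_polys t a"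
| coord: "f \<in> gaussian_polys t a \<Longrightarrow> (\<lambda>x. of_real (x $ j) * f x) \<in> gaussian_polys t a"

text \<open>The class consists of complex polynomials times one fixed Gaussian. A partial derivative
  of the Gaussian brings down the affine factor \<open>- t * (x $ i - a $ i)\<close>, and the sum
  and product rules keep the other constructors inside, so every iterated partial derivative stays
  in the class.\<close>

lemma gaussian_polys_derivative:
  fixes a :: "real^'n"
  assumes "f \<in> gaussian_polys t a"
  shows "\<exists>f'. (\<forall>x. (f has_derivative f' x) (at x)) \<and> (\<forall>i. (\<lambda>x. f' x (axis i 1)) \<in> gaussian_polys t a)"
  using assms
proof induction
  case gaussian
  define f' where "f' x h = of_real (- t * ((x - a) \<bullet> h)) * gaussian t a 0 x" for x h
  have "(gaussian t a 0 has_derivative f' x) (at x)" for x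
  proof -
    have "((\<lambda>x. exp (- (t / 2) * ((x - a) \<bullet> (x - a)))) has_derivative
        (\<lambda>h. - t * ((x - a) \<bullet> h) * exp (- (t / 2) * ((x - a) \<bullet> (x - a))))) (at x)"
      by (auto intro!: derivative_eq_intros simp: inner_commute)
    from has_derivative_of_real[OF this, where ?'a = complex] show ?thesis
      by (simp add: gaussian_0[abs_def] f'_def[abs_def] power2_norm_eq_inner)
  qed
  moreover have "(\<lambda>x. f' x (axis i 1)) \<in> gaussian_polys t a" for i
  proof -
    have "(\<lambda>x. of_real (- t) * (of_real (x $ i) * gaussian t a 0 x) + of_real (t * a $ i) * gaussian t a 0 x)
        \<in> gaussian_polys t a"
      by (intro gaussian_polys.intros)
    also have "(\<lambda>x. of_real (- t) * (of_real (x $ i) * gaussian t a 0 x) + of_real (t * a $ i) * gaussian t a 0 x)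
        = (\<lambda>x. f' x (axis i 1))"
      by (auto simp: f'_def inner_axis algebra_simps)
    finally show ?thesis .
  qed
  ultimately show ?case by blast
next
  case (add f g)
  then obtain f' g' where
    f: "\<And>x. (f has_derivative f' x) (at x)" "\<And>i. (\<lambda>x. f' x (axis i 1)) \<in> gaussian_polys t a" and
    g: "\<And>x. (g has_derivative g' x) (at x)" "\<And>i. (\<lambda>x. g' x (axis i 1)) \<in> gaussian_polys t a"
    by metis
  show ?case
    by (intro exI[of _ "\<lambda>x h. f' x h + g' x h"] conjI allI has_derivative_add f g gaussian_polys.add)
next
  case (cmult f c)
  then obtain f' where
    f: "\<And>x. (f has_derivative f' x) (at x)" "\<And>i. (\<lambda>x. f' x (axis i 1)) \<in> gaussian_polys t a"
    by metis
  show ?case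
    by (intro exI[of _ "\<lambda>x h. c * f' x h"] conjI allI has_derivative_mult_right f gaussian_polys.cmult)
next
  case (coord f j)
  then obtain f' where
    f: "\<And>x. (f has_derivative f' x) (at x)" "\<And>i. (\<lambda>x. f' x (axis i 1)) \<in> gaussian_polys t a"
    by metis
  show ?case
  proof (intro exI[of _ "\<lambda>x h. of_real (x $ j) * f' x h + of_real (h $ j) * f x"] conjI allI)
    have "((\<lambda>x. x $ j) has_derivative (\<lambda>h. h $ j)) (at x)" for x :: "real^'n"
      by (intro bounded_linear_imp_has_derivative bounded_linear_vec_nth)
    from has_derivative_mult[OF has_derivative_of_real[OF this] f(1)]
    show "((\<lambda>x. of_real (x $ j) * f x) has_derivative (\<lambda>h. of_real (x $ j) * f' x h + of_real (h $ j) * f x)) (at x)" for x .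
    show "(\<lambda>x. of_real (x $ j) * f' x (axis i 1) + of_real (axis i 1 $ j) * f x) \<in> gaussian_polys t a" for i
      by (intro gaussian_polys.add gaussian_polys.coord gaussian_polys.cmult f coord)
  qed
qed

lemma gaussian_polys_iter_partial:
  assumes "f \<in> gaussian_polys t a"
  shows "iter_partial is f \<in> gaussian_polys t a"
proof (induction "is")
  case (Cons i "is")
  obtain f' where f': "\<And>x. (iter_partial is f has_derivative f' x) (at x)"
      "\<And>i. (\<lambda>x. f' x (axis i 1)) \<in> gaussian_polys t a"
    using gaussian_polys_derivative[OF Cons.IH] by metis
  then show ?case
    by (simp add: frechet_derivative_at[OF f'(1), symmetric])
qed (simp add: assms)

lemma gaussian_polys_monomial:
  assumes f: "f \<in> gaussian_polys t a" and "finite A"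
  shows "(\<lambda>x. of_real (\<Prod>j\<in>A. (x $ j) ^ \<alpha> j) * f x) \<in> gaussian_polys t a"
  using \<open>finite A\<close>
proof induction
  case (insert j A)
  have "(\<lambda>x. of_real ((x $ j) ^ m) * (of_real (\<Prod>j\<in>A. (x $ j) ^ \<alpha> j) * f x)) \<in> gaussian_polys t a" for m
  proof (induction m)
    case (Suc m)
    from gaussian_polys.coord[OF this, of j] show ?case
      by (simp add: mult.assoc)
  qed (use insert.IH in simp)
  then show ?case
    using insert.hyps by (simp add: mult.assoc)
qed (simp add: f)

lemma gaussian_polys_bound:
  fixes a :: "real^'n"
  assumes "f \<in> gaussian_polys t a" and t: "t > 0"
  shows "\<exists>C k. \<forall>x. norm (f x) \<le> C * ((1 + norm (x - a)) ^ k * exp (- (t / 2) * (norm (x - a))\<^sup>2))"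
  using assms(1)
proof induction
  case gaussian
  show ?case
    by (intro exI[of _ 1] exI[of _ 0]) (simp add: norm_gaussian)
next
  case (add f g)
  define E where "E x = exp (- (t / 2) * (norm (x - a))\<^sup>2)" for x
  from add.IH obtain C k D l where
    b: "\<And>x. norm (f x) \<le> C * ((1 + norm (x - a)) ^ k * E x)" "\<And>x. norm (g x) \<le> D * ((1 + norm (x - a)) ^ l * E x)"
    unfolding E_def by metis
  have "norm (f x + g x) \<le> (\<bar>C\<bar> + \<bar>D\<bar>) * ((1 + norm (x - a)) ^ (k + l) * E x)" for x
  proof -
    have p: "(1 + norm (x - a)) ^ k \<le> (1 + norm (x - a)) ^ (k + l)" "(1 + norm (x - a)) ^ l \<le> (1 + norm (x - a)) ^ (k + l)"
      by (intro power_increasing; simp)+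
    have "C * ((1 + norm (x - a)) ^ k * E x) \<le> \<bar>C\<bar> * ((1 + norm (x - a)) ^ (k + l) * E x)"
      by (intro mult_mono mult_right_mono p) (auto simp: E_def)
    moreover have "D * ((1 + norm (x - a)) ^ l * E x) \<le> \<bar>D\<bar> * ((1 + norm (x - a)) ^ (k + l) * E x)"
      by (intro mult_mono mult_right_mono p) (auto simp: E_def)
    ultimately show ?thesis
      using b[of x] norm_triangle_ineq[of "f x" "g x"] by (simp add: distrib_right)
  qed
  then show ?case unfolding E_def by blast
next
  case (cmult f c)
  then obtain C k where b: "\<And>x. norm (f x) \<le> C * ((1 + norm (x - a)) ^ k * exp (- (t / 2) * (norm (x - a))\<^sup>2))"
    by metis
  have "norm (c * f x) \<le> (cmod c * C) * ((1 + norm (x - a)) ^ k * exp (- (t / 2) * (norm (x - a))\<^sup>2))" for x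
    using mult_left_mono[OF b norm_ge_zero] by (simp add: norm_mult mult.assoc)
  then show ?case by blast
next
  case (coord f j)
  define E where "E x = exp (- (t / 2) * (norm (x - a))\<^sup>2)" for x
  from coord obtain C k where b: "\<And>x. norm (f x) \<le> C * ((1 + norm (x - a)) ^ k * E x)"
    unfolding E_def by metis
  \<comment> \<open>A coordinate is at most \<open>(1 + norm a) * (1 + norm (x - a))\<close>, so
    each multiplication by one raises the exponent by 1.\<close>
  have "norm (of_real (x $ j) * f x) \<le> ((1 + norm a) * C) * ((1 + norm (x - a)) ^ Suc k * E x)" for x
  proof -
    have "\<bar>x $ j\<bar> \<le> norm x" by (rule component_le_norm_cart)
    also have "\<dots> \<le> norm (x - a) + norm a"
      using norm_triangle_ineq[of "x - a" a] by simp
    also have "\<dots> \<le> (1 + norm a) * (1 + norm (x - a))"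
      by (simp add: algebra_simps)
    finally have "\<bar>x $ j\<bar> * norm (f x) \<le> ((1 + norm a) * (1 + norm (x - a))) * (C * ((1 + norm (x - a)) ^ k * E x))"
      by (intro mult_mono b) auto
    then show ?thesis
      by (simp add: norm_mult mult_ac)
  qed
  then show ?case unfolding E_def by blast
qed

text \<open>One term of the exponential series gives
  \<open>(1 + r) ^ k \<le> fact k * exp (1 + r)\<close>, and completing the square gives
  \<open>r - (t / 2) * r\<^sup>2 \<le> 1 / (2 * t)\<close>.\<close>

lemma power_mult_gaussian_bounded:
  fixes r t :: real
  assumes t: "t > 0" and r: "r \<ge> 0"
  shows "(1 + r) ^ k * exp (- (t / 2) * r\<^sup>2) \<le> fact k * exp (1 + 1 / (2 * t))"
proof -
  have "(1 + r) ^ k / fact k \<le> exp (1 + r)"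
  proof -
    have "(\<Sum>n\<in>{k}. (1 + r) ^ n /\<^sub>R fact n) \<le> (\<Sum>n. (1 + r) ^ n /\<^sub>R fact n)"
      using r by (intro sum_le_suminf summable_exp_generic) auto
    then show ?thesis
      by (simp add: exp_def divide_inverse mult.commute)
  qed
  then have "(1 + r) ^ k * exp (- (t / 2) * r\<^sup>2) \<le> fact k * exp (1 + r) * exp (- (t / 2) * r\<^sup>2)"
    by (intro mult_right_mono) (auto simp: field_simps)
  also have "\<dots> = fact k * exp (1 + r - (t / 2) * r\<^sup>2)"
    by (simp only: mult.assoc exp_add[symmetric]) simp
  also have "\<dots> \<le> fact k * exp (1 + 1 / (2 * t))"
  proof -
    have "0 \<le> (t * r - 1)\<^sup>2" by simp
    then have "2 * t * r \<le> t * t * r\<^sup>2 + 1"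
      by (simp add: power2_eq_square algebra_simps)
    then have "1 + r - (t / 2) * r\<^sup>2 \<le> 1 + 1 / (2 * t)"
      using t by (simp add: field_simps power2_eq_square)
    then show ?thesis by simp
  qed
  finally show ?thesis .
qed

lemma gaussian_schwartz:
  fixes a :: "real^'n"
  assumes t: "t > 0"
  shows "gaussian t a 0 \<in> schwartz"
  unfolding schwartz_def
proof (intro CollectI conjI allI)
  have G: "iter_partial is (gaussian t a 0) \<in> gaussian_polys t a" for "is"
    by (intro gaussian_polys_iter_partial gaussian_polys.gaussian)
  show "iter_partial is (gaussian t a 0) differentiable (at x)" for "is" x
    using gaussian_polys_derivative[OF G, of "is"] unfolding differentiable_def by metis
  fix \<alpha> :: "'n \<Rightarrow> nat" and "is" :: "'n list"
  have "(\<lambda>x. of_real (\<Prod>j\<in>UNIV. (x $ j) ^ \<alpha> j) * iter_partial is (gaussian t a 0) x) \<in> gaussian_polys t a"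
    by (intro gaussian_polys_monomial G) simp
  from gaussian_polys_bound[OF this t] obtain C k where
    b: "\<And>x. norm (of_real (\<Prod>j\<in>UNIV. (x $ j) ^ \<alpha> j) * iter_partial is (gaussian t a 0) x)
      \<le> C * ((1 + norm (x - a)) ^ k * exp (- (t / 2) * (norm (x - a))\<^sup>2))"
    by metis
  show "bounded (range (\<lambda>x. (\<Prod>j\<in>UNIV. (x $ j) ^ \<alpha> j) *\<^sub>R iter_partial is (gaussian t a 0) x))"
  proof (rule boundedI, safe)
    fix x
    have "C * ((1 + norm (x - a)) ^ k * exp (- (t / 2) * (norm (x - a))\<^sup>2))
        \<le> \<bar>C\<bar> * (fact k * exp (1 + 1 / (2 * t)))"
      by (intro mult_mono power_mult_gaussian_bounded t) auto
    with b[of x] show "norm ((\<Prod>j\<in>UNIV. (x $ j) ^ \<alpha> j) *\<^sub>R iter_partial is (gaussian t a 0) x)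
        \<le> \<bar>C\<bar> * (fact k * exp (1 + 1 / (2 * t)))"
      unfolding scaleR_conv_of_real by linarith
  qed
qed

subsection \<open>The metaplectic kernel operator\<close>

text \<open>Resolves the definite description: a competing operator agrees with \<open>T\<close> on
  Schwartz functions, in particular on Gaussians, and is therefore equal to
  \<open>T\<close>.\<close>

lemma kernel_operatorI:
  fixes T :: "(real^'n) L2 \<Rightarrow> (real^'n) L2"
  assumes T: "bounded_operator_L2 T"
    and eq: "\<And>\<phi>. \<phi> \<in> schwartz \<Longrightarrow> square_integrable (integral_transform a \<phi>)
      \<and> T (abs_L2 \<phi>) = abs_L2 (integral_transform a \<phi>)"
  shows "kernel_operator a = T"
  unfolding kernel_operator_def
proof (rule the_equality)
  fix S assume S: "bounded_operator_L2 S \<and>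
    (\<forall>\<phi>\<in>schwartz. square_integrable (integral_transform a \<phi>) \<and> S (abs_L2 \<phi>) = abs_L2 (integral_transform a \<phi>))"
  show "S = T"
  proof (rule bounded_operator_eqI)
    fix t :: real and b :: "real^'n" assume "t > 0"
    then have g: "gaussian t b 0 \<in> schwartz" by (rule gaussian_schwartz)
    with S have "S (abs_L2 (gaussian t b 0)) = abs_L2 (integral_transform a (gaussian t b 0))" by blast
    with eq[OF g] show "S (abs_L2 (gaussian t b 0)) = T (abs_L2 (gaussian t b 0))" by simp
  qed (use S T in auto)
qed (use T eq in auto)

lemma det_scaleR: "det (r *\<^sub>R (A :: real^'n^'n)) = r ^ CARD('n) * det A"
  using det_rows_mul[of "\<lambda>_. r" "\<lambda>i. A $ i"] by (simp add: scalar_mult_eq_scaleR scaleR_vec_def)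

text \<open>\<open>T\<close> is obtained before \<open>c\<close> is fixed, so the constant enters
  only as a scalar factor and the norm scaling of the kernel operator is
  \<open>cmod c * k\<close>.\<close>

lemma kernel_operator_metaplectic:
  fixes A B D :: "real^'n^'n"
  assumes lam: "lam > 0" and B: "det B \<noteq> 0"
  defines "k \<equiv> sqrt ((2 * pi / lam) ^ CARD('n) * \<bar>det B\<bar>)"
  obtains T where "scaled_unitary k T"
    "\<And>c. kernel_operator (metaplectic_kernel lam A B D c) = (\<lambda>u. scaleC_L2 c (T u))"
proof -
  \<comment> \<open>The mixed term of the kernel's exponent is \<open>\<i>\<close> times
    \<open>(R *v x) \<bullet> y\<close>, which is why the transform with sign 1 is evaluated at
    \<open>R *v x\<close>. The two pure quadratic terms are real, so they give the unimodular
    factors \<open>p\<close> and \<open>q\<close>.\<close>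
  define R where "R = lam *\<^sub>R matrix_inv B"
  define p where "p x = iexp (- (lam / 2) * (x \<bullet> ((D ** matrix_inv B) *v x)))" for x
  define q where "q y = iexp (- (lam / 2) * (y \<bullet> ((matrix_inv B ** A) *v y)))" for y
  have cont: "continuous_on UNIV (\<lambda>x. iexp (r * (x \<bullet> (M *v x))))" for r and M :: "real^'n^'n"
    by (intro continuous_intros linear_continuous_on_compose[OF continuous_on_id]) simp
  have p: "p \<in> borel_measurable borel" "\<And>x. norm (p x) = 1"
    and q: "q \<in> borel_measurable borel" "\<And>x. norm (q x) = 1"
    unfolding p_def[abs_def] q_def[abs_def]
    by (simp_all only: norm_exp_i_times borel_measurable_continuous_onI[OF cont])
  have "B ** matrix_inv B = mat 1"
    using B unfolding invertible_det_nz[symmetric] invertible_def matrix_inv_def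
    by (rule someI2_ex) auto
  then have "det B * det (matrix_inv B) = 1"
    by (metis det_I det_mul)
  then have detB: "det (matrix_inv B) = 1 / det B"
    using B by (simp add: field_simps)
  have detR: "\<bar>det R\<bar> = lam ^ CARD('n) / \<bar>det B\<bar>"
    using lam by (simp add: R_def det_scaleR detB abs_mult)
  have R: "det R \<noteq> 0"
    using detR lam B by auto
  define T where "T u = mult_L2 p (subst_L2 R (fourier_L2 1 (mult_L2 q u)))" for u
  have "scaled_unitary (1 * (1 / sqrt \<bar>det R\<bar> * (sqrt ((2 * pi) ^ DIM(real^'n)) * 1))) T"
    unfolding T_def[abs_def]
    by (rule scaled_unitary_compose[OF scaled_unitary_mult_L2[OF p]
        scaled_unitary_compose[OF scaled_unitary_subst_L2[OF R]
          scaled_unitary_compose[OF scaled_unitary_fourier_L2 scaled_unitary_mult_L2[OF q]]]]) simp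
  also have "1 * (1 / sqrt \<bar>det R\<bar> * (sqrt ((2 * pi) ^ DIM(real^'n)) * 1)) = k"
  proof -
    have "(2 * pi / lam) ^ CARD('n) * \<bar>det B\<bar> = (2 * pi) ^ DIM(real^'n) / \<bar>det R\<bar>"
      unfolding detR by (simp add: power_divide)
    then show ?thesis
      unfolding k_def by (simp add: real_sqrt_divide)
  qed
  finally have T: "scaled_unitary k T" .
  have "kernel_operator (metaplectic_kernel lam A B D c) = (\<lambda>u. scaleC_L2 c (T u))" for c
  proof (rule kernel_operatorI)
    show "bounded_operator_L2 (\<lambda>u. scaleC_L2 c (T u))"
      using T by (intro bounded_operator_compose[OF bounded_operator_scaleC]) (simp add: scaled_unitary_def)
    fix \<phi> :: "real^'n \<Rightarrow> complex" assume "\<phi> \<in> schwartz"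
    note \<phi> = integrable_schwartz[OF this] schwartz_measurable[OF this]
    let ?\<psi> = "\<lambda>y. q y * \<phi> y"
    have \<psi>2: "square_integrable ?\<psi>"
      by (rule square_integrable_unimodular_mult[OF q \<phi>(2)])
    have \<psi>1: "integrable lborel ?\<psi>"
      by (rule Bochner_Integration.integrable_bound[OF \<phi>(1)]) (use q \<phi>(3) in \<open>auto simp: norm_mult\<close>)
    have F: "square_integrable (fourier 1 ?\<psi>)"
      by (intro square_integrable_fourier \<psi>1 \<psi>2) simp
    have FR: "square_integrable (\<lambda>x. fourier 1 ?\<psi> (R *v x))"
      by (rule square_integrable_subst[OF R F])
    have pFR: "square_integrable (\<lambda>x. p x * fourier 1 ?\<psi> (R *v x))"
      by (rule square_integrable_unimodular_mult[OF p FR])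
    have eq: "integral_transform (metaplectic_kernel lam A B D c) \<phi> = (\<lambda>x. c * (p x * fourier 1 ?\<psi> (R *v x)))"
    proof
      fix x
      have "metaplectic_kernel lam A B D c x y * \<phi> y = (c * p x) * (iexp (1 * ((R *v x) \<bullet> y)) * ?\<psi> y)" for y
        unfolding metaplectic_kernel_def p_def q_def R_def
        by (simp add: exp_add[symmetric] scaleR_matrix_vector_assoc[symmetric] algebra_simps flip: exp_add)
      then show "integral_transform (metaplectic_kernel lam A B D c) \<phi> x = c * (p x * fourier 1 ?\<psi> (R *v x))"
        by (simp only: integral_transform_def fourier_def integral_mult_right_zero mult.assoc)
    qed
    have "T (abs_L2 \<phi>) = abs_L2 (\<lambda>x. p x * fourier 1 ?\<psi> (R *v x))"
      unfolding T_def
      by (simp only: mult_L2_abs[OF q \<phi>(2)] fourier_L2_abs[OF _ \<psi>1 \<psi>2] power_one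
          subst_L2_abs[OF R F] mult_L2_abs[OF p FR])
    then show "square_integrable (integral_transform (metaplectic_kernel lam A B D c) \<phi>) \<and>
        scaleC_L2 c (T (abs_L2 \<phi>)) = abs_L2 (integral_transform (metaplectic_kernel lam A B D c) \<phi>)"
      unfolding eq by (simp add: abs_L2_scaleC pFR square_integrable_cmult)
  qed
  with T that show ?thesis by blast
qed

theorem proposition5p3:
  fixes lam :: real and A B C D :: "real^'n^'n" and c :: complex
  assumes "lam > 0"
    and "block_matrix A B C D \<in> Sp"
    and "det B \<noteq> 0"
  shows "unitary_L2 (kernel_operator (metaplectic_kernel lam A B D c)) \<longleftrightarrow>
    cmod c = (lam / (2 * pi)) powr (real CARD('n) / 2) * \<bar>det B\<bar> powr (- 1 / 2)"
proof -
  \<comment> \<open>The right-hand side of the claim is \<open>1 / k\<close> written with real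
    powers, where \<open>k\<close> is the factor by which \<open>T\<close> scales norms.\<close>
  define k where "k = sqrt ((2 * pi / lam) ^ CARD('n) * \<bar>det B\<bar>)"
  obtain T where T: "scaled_unitary k T"
    "kernel_operator (metaplectic_kernel lam A B D c) = (\<lambda>u. scaleC_L2 c (T u))"
    using kernel_operator_metaplectic[OF assms(1,3)] unfolding k_def by metis
  have k: "k > 0"
    using assms by (simp add: k_def)
  have "(lam / (2 * pi)) powr (real CARD('n) / 2) = sqrt ((lam / (2 * pi)) ^ CARD('n))"
    using assms(1) by (simp add: powr_half_sqrt[symmetric] powr_powr powr_realpow[symmetric])
  moreover have "\<bar>det B\<bar> powr (- 1 / 2) = 1 / sqrt \<bar>det B\<bar>"
    using assms(3) by (simp add: powr_minus_divide powr_half_sqrt)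
  ultimately have eq: "(lam / (2 * pi)) powr (real CARD('n) / 2) * \<bar>det B\<bar> powr (- 1 / 2) = 1 / k"
    using assms by (simp add: k_def real_sqrt_mult real_sqrt_divide power_divide)
  show ?thesis
    unfolding eq T(2) unitary_scaleC_scaled_unitary_iff[OF T(1) k] using k by (simp add: field_simps)
qed

end
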